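(* Given an integer $\Delta\ge 4$, let $C_\Delta\vee I_2$ denote the join of the cycle $C_\Delta$ with $\Delta$ vertices and the independent set $I_2$ with two vertices. Then $$\chi'_{ur}(C_\Delta\vee I_2)=\begin{cases}2\Delta+4, & \text{if } \Delta=4,\\ 2\Delta, & \text{otherwise,}\end{cases}\qquad\text{and}\qquad \chi'_{ss}(C_\Delta\vee I_2)=\begin{cases}2\Delta+4, & \text{if } \Delta=4\text{ or }\Delta=7,\\ 2\Delta+3, & \text{otherwise.}\end{cases}$$ Moreover, there exist infinitely many planar graphs with maximum degree $7$ and semistrong chromatic index at least $18$.
   Context: Graphs are finite, undirected and simple. The join of two graphs is obtained from their disjoint union by adding all edges between a vertex of the first and a vertex of the second. A matching $M$ of a graph $G$ is a set of pairwise disjoint edges; $G_M$ denotes the subgraph of $G$ induced by the vertices covered by $M$. An edge is pendant in a graph if at least one of its endvertices has degree $1$ in that graph. A matching $M$ of $G$ is uniquely restricted if $M$ is the unique perfect matching of $G_M$; it is semistrong if every edge of $M$ is pendant in $G_M$. A uniquely restricted (resp. semistrong) edge coloring of $G$ is an assignment of colors to the edges of $G$ such that every color class is a uniquely restricted (resp. semistrong) matching of $G$. The uniquely restricted chromatic index $\chi'_{ur}(G)$ (resp. semistrong chromatic index $\chi'_{ss}(G)$) is the minimum number of colors in such a coloring. *)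

theory Defs
  imports "HOL-Analysis.Analysis"
begin

record 'a graph =
  verts :: "'a set"
  edges :: "'a set set"

definition simple_graph :: "'a graph \<Rightarrow> bool" where
  "simple_graph G \<longleftrightarrow> finite (verts G) \<and> (\<forall>e\<in>edges G. e \<subseteq> verts G \<and> card e = 2)"

definition degree :: "'a graph \<Rightarrow> 'a \<Rightarrow> nat" where
  "degree G v = card {e \<in> edges G. v \<in> e}"

definition max_degree :: "'a graph \<Rightarrow> nat" where
  "max_degree G = Max (degree G ` verts G)"

definition induced_subgraph :: "'a graph \<Rightarrow> 'a set \<Rightarrow> 'a graph" where
  "induced_subgraph G S = \<lparr>verts = S, edges = {e \<in> edges G. e \<subseteq> S}\<rparr>"

definition isomorphic :: "'a graph \<Rightarrow> 'b graph \<Rightarrow> bool" where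
  "isomorphic G H \<longleftrightarrow>
     (\<exists>f. bij_betw f (verts G) (verts H) \<and> edges H = (\<lambda>e. f ` e) ` edges G)"

definition graph_join :: "'a graph \<Rightarrow> 'b graph \<Rightarrow> ('a + 'b) graph" where
  "graph_join G H =
     \<lparr>verts = verts G <+> verts H,
      edges = (\<lambda>e. Inl ` e) ` edges G \<union> (\<lambda>e. Inr ` e) ` edges H
              \<union> {{Inl u, Inr v} | u v. u \<in> verts G \<and> v \<in> verts H}\<rparr>"

(* A cycle only for n \<ge> 3. *)
definition cycle_graph :: "nat \<Rightarrow> nat graph" where
  "cycle_graph n = \<lparr>verts = {..<n}, edges = {{i, (i + 1) mod n} | i. i < n}\<rparr>"

definition independent_graph :: "nat \<Rightarrow> nat graph" where
  "independent_graph n = \<lparr>verts = {..<n}, edges = {}\<rparr>"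

definition matching :: "'a graph \<Rightarrow> 'a set set \<Rightarrow> bool" where
  "matching G M \<longleftrightarrow> M \<subseteq> edges G \<and> pairwise disjnt M"

definition perfect_matching :: "'a graph \<Rightarrow> 'a set set \<Rightarrow> bool" where
  "perfect_matching G M \<longleftrightarrow> matching G M \<and> \<Union>M = verts G"

definition matching_subgraph :: "'a graph \<Rightarrow> 'a set set \<Rightarrow> 'a graph" where
  "matching_subgraph G M = induced_subgraph G (\<Union>M)"

definition pendant :: "'a graph \<Rightarrow> 'a set \<Rightarrow> bool" where
  "pendant G e \<longleftrightarrow> e \<in> edges G \<and> (\<exists>v\<in>e. degree G v = 1)"

definition uniquely_restricted :: "'a graph \<Rightarrow> 'a set set \<Rightarrow> bool" where
  "uniquely_restricted G M \<longleftrightarrow> matching G M \<and>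
     perfect_matching (matching_subgraph G M) M \<and>
     (\<forall>M'. perfect_matching (matching_subgraph G M) M' \<longrightarrow> M' = M)"

definition semistrong :: "'a graph \<Rightarrow> 'a set set \<Rightarrow> bool" where
  "semistrong G M \<longleftrightarrow> matching G M \<and> (\<forall>e\<in>M. pendant (matching_subgraph G M) e)"

definition ur_edge_coloring :: "'a graph \<Rightarrow> ('a set \<Rightarrow> nat) \<Rightarrow> bool" where
  "ur_edge_coloring G c \<longleftrightarrow> (\<forall>i. uniquely_restricted G {e \<in> edges G. c e = i})"

definition ss_edge_coloring :: "'a graph \<Rightarrow> ('a set \<Rightarrow> nat) \<Rightarrow> bool" where
  "ss_edge_coloring G c \<longleftrightarrow> (\<forall>i. semistrong G {e \<in> edges G. c e = i})"

definition ur_chromatic_index :: "'a graph \<Rightarrow> nat" where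
  "ur_chromatic_index G =
     (LEAST k. \<exists>c. ur_edge_coloring G c \<and> c ` edges G \<subseteq> {..<k})"

definition ss_chromatic_index :: "'a graph \<Rightarrow> nat" where
  "ss_chromatic_index G =
     (LEAST k. \<exists>c. ss_edge_coloring G c \<and> c ` edges G \<subseteq> {..<k})"

(* Topological planarity, with the type complex as the Euclidean plane: distinct vertices go to
   distinct points p v, every edge e to a simple arc \<gamma> e joining the images of its ends and
   passing through no other vertex, and two arcs meet only in the images of common ends. *)
definition planar :: "'a graph \<Rightarrow> bool" where
  "planar G \<longleftrightarrow>
     (\<exists>(p :: 'a \<Rightarrow> complex) (\<gamma> :: 'a set \<Rightarrow> real \<Rightarrow> complex).
        inj_on p (verts G) \<and>
        (\<forall>e\<in>edges G. arc (\<gamma> e) \<and> {pathstart (\<gamma> e), pathfinish (\<gamma> e)} = p ` e \<and>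
           path_image (\<gamma> e) \<inter> p ` verts G = p ` e) \<and>
        (\<forall>e\<in>edges G. \<forall>f\<in>edges G. e \<noteq> f \<longrightarrow>
           path_image (\<gamma> e) \<inter> path_image (\<gamma> f) \<subseteq> p ` (e \<inter> f)))"

end

theory Submission
  imports Defs
begin

text \<open>The graph is a cycle, the rim, whose vertices are all joined to two non-adjacent hubs. A hub
sees every rim vertex, and this almost decides which edges can share a color.

Two disjoint spokes lead to different hubs, so they span an alternating 4-cycle and never lie in one
uniquely restricted matching (\<open>ur_spokes_eq\<close>): the \<open>2n\<close> spokes need \<open>2n\<close> colors. For \<open>n \<ge> 5\<close> the rim
edges cost nothing: the rim edge at \<open>j\<close>, \<open>j + 1\<close> may share the color of a spoke at \<open>j + 3\<close>, which is
adjacent to neither \<open>j\<close> nor \<open>j + 1\<close> (\<open>ur_rim_spoke\<close>). For \<open>n = 4\<close> any two disjoint edges lie on an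
alternating 4-cycle, so all twelve edges need different colors.

In a semistrong matching a spoke is alone (\<open>semistrong_spoke_alone\<close>): its hub spoils the degrees of
all covered rim vertices. Hence the index is \<open>2n\<close> plus the number of colors for the rim, where a
color class is admissible iff it contains neither two consecutive rim edges nor the three edges
\<open>j\<close>, \<open>j + 2\<close>, \<open>j + 4\<close> (indices modulo \<open>n\<close>), because in the latter case both ends of the middle edge
have a second covered neighbor. Two colors would alternate and produce such a triple. Three colors
suffice when \<open>n\<close> is a sum of threes and fives, by concatenating the words \<open>012\<close> and \<open>01012\<close>; this
leaves out exactly \<open>4\<close> and \<open>7\<close> among the \<open>n \<ge> 4\<close>. For \<open>n = 4\<close> no two rim edges can share a color,
and for \<open>n = 7\<close> no three can, so that four colors are required in both cases.

The double wheel over the 7-cycle is planar of maximum degree 7 and has semistrong chromatic index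
18. Adding isolated vertices changes none of this and yields graphs of pairwise different order. For
planarity a straight-line drawing with integer coordinates is checked by orientation signs.\<close>

section \<open>Semistrong and uniquely restricted matchings\<close>

lemma card_eq_1_iff_singleton: "x \<in> S \<Longrightarrow> card S = 1 \<longleftrightarrow> S = {x}"
  unfolding One_nat_def card_1_singleton_iff by auto

lemma pendant_matching_subgraph_iff:
  assumes "M \<subseteq> edges G" "e \<in> M"
  shows "pendant (matching_subgraph G M) e \<longleftrightarrow>
    (\<exists>v\<in>e. \<forall>f\<in>edges G. f \<subseteq> \<Union>M \<longrightarrow> v \<in> f \<longrightarrow> f = e)"
proof -
  have e: "e \<in> edges (matching_subgraph G M)"
    using assms by (auto simp: matching_subgraph_def induced_subgraph_def)
  have "degree (matching_subgraph G M) v = 1 \<longleftrightarrow>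
      (\<forall>f\<in>edges G. f \<subseteq> \<Union>M \<longrightarrow> v \<in> f \<longrightarrow> f = e)" if "v \<in> e" for v
  proof -
    have "e \<in> {f \<in> edges (matching_subgraph G M). v \<in> f}"
      using e that by simp
    then have "degree (matching_subgraph G M) v = 1 \<longleftrightarrow>
        {f \<in> edges (matching_subgraph G M). v \<in> f} = {e}"
      unfolding degree_def by (rule card_eq_1_iff_singleton)
    also have "\<dots> \<longleftrightarrow> (\<forall>f\<in>edges (matching_subgraph G M). v \<in> f \<longrightarrow> f = e)"
      using e that by auto
    also have "\<dots> \<longleftrightarrow> (\<forall>f\<in>edges G. f \<subseteq> \<Union>M \<longrightarrow> v \<in> f \<longrightarrow> f = e)"
      by (auto simp: matching_subgraph_def induced_subgraph_def)
    finally show ?thesis .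
  qed
  then show ?thesis unfolding pendant_def using e by simp
qed

text \<open>With the induced subgraph and the degrees eliminated, later arguments only have to look for edges of
\<open>G\<close> between covered vertices.\<close>

lemma semistrong_iff:
  "semistrong G M \<longleftrightarrow> M \<subseteq> edges G \<and> pairwise disjnt M \<and>
     (\<forall>e\<in>M. \<exists>v\<in>e. \<forall>f\<in>edges G. f \<subseteq> \<Union>M \<longrightarrow> v \<in> f \<longrightarrow> f = e)"
  unfolding semistrong_def matching_def
  by (simp add: pendant_matching_subgraph_iff cong: conj_cong)

lemma uniquely_restricted_iff:
  "uniquely_restricted G M \<longleftrightarrow> M \<subseteq> edges G \<and> pairwise disjnt M \<and>
     (\<forall>M'. M' \<subseteq> edges G \<longrightarrow> pairwise disjnt M' \<longrightarrow> \<Union>M' = \<Union>M \<longrightarrow> M' = M)"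
proof -
  have "perfect_matching (matching_subgraph G M) M' \<longleftrightarrow>
          M' \<subseteq> edges G \<and> pairwise disjnt M' \<and> \<Union>M' = \<Union>M" for M'
    unfolding perfect_matching_def matching_def matching_subgraph_def induced_subgraph_def
    by (simp add: subset_iff) fast
  then show ?thesis
    unfolding uniquely_restricted_def matching_def by (simp add: imp_conjL) (rule iffI; simp)
qed

lemma uniquely_restrictedD:
  "uniquely_restricted G M \<Longrightarrow> N \<subseteq> edges G \<Longrightarrow> pairwise disjnt N \<Longrightarrow> \<Union>N = \<Union>M \<Longrightarrow> N = M"
  by (simp add: uniquely_restricted_iff)

lemma semistrong_disjoint: "semistrong G M \<Longrightarrow> pairwise disjnt M"
  by (simp add: semistrong_iff)

lemma uniquely_restricted_disjoint: "uniquely_restricted G M \<Longrightarrow> pairwise disjnt M"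
  by (simp add: uniquely_restricted_iff)

lemma semistrong_singleton:
  assumes "e \<in> edges G" "e \<noteq> {}" "\<And>f. f \<in> edges G \<Longrightarrow> f \<subseteq> e \<Longrightarrow> f = e"
  shows "semistrong G {e}"
  using assms by (auto simp: semistrong_iff)

lemma uniquely_restricted_empty:
  assumes "{} \<notin> edges G"
  shows "uniquely_restricted G {}"
  using assms by (auto simp: uniquely_restricted_iff)

text \<open>The peeling step: if \<open>v\<close> has no covered neighbor besides its partner, then every perfect matching of
the covered vertices must use \<open>e\<close>, and its other edges form a perfect matching of the vertices covered by \<open>M\<close>.\<close>

lemma uniquely_restricted_insert:
  assumes M: "uniquely_restricted G M"
    and e: "e \<in> edges G" "\<And>f. f \<in> M \<Longrightarrow> disjnt e f"
    and v: "v \<in> e" "\<And>f. f \<in> edges G \<Longrightarrow> f \<subseteq> \<Union>(insert e M) \<Longrightarrow> v \<in> f \<Longrightarrow> f = e"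
  shows "uniquely_restricted G (insert e M)"
  unfolding uniquely_restricted_iff
proof (intro conjI allI impI)
  show "insert e M \<subseteq> edges G" using M e by (auto simp: uniquely_restricted_iff)
  show "pairwise disjnt (insert e M)"
    using M e by (auto simp: uniquely_restricted_iff pairwise_insert disjnt_sym)
  fix M' assume M': "M' \<subseteq> edges G" "pairwise disjnt M'" "\<Union>M' = \<Union>(insert e M)"
  obtain f where "f \<in> M'" "v \<in> f" using M'(3) v(1) by blast
  then have "e \<in> M'" using v(2)[of f] M' by blast
  have "\<Union>(M' - {e}) = \<Union>M"
  proof -
    have "disjnt e f" if "f \<in> M' - {e}" for f
      using pairwiseD[OF M'(2) \<open>e \<in> M'\<close>, of f] that by blast
    then have "\<Union>(M' - {e}) = \<Union>M' - e" by (auto simp: disjnt_iff)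
    also have "\<dots> = \<Union>(insert e M) - e" unfolding M'(3) ..
    also have "\<dots> = \<Union>M" using e(2) by (auto simp: disjnt_iff)
    finally show ?thesis .
  qed
  moreover have "pairwise disjnt (M' - {e})" using M'(2) by (auto simp: pairwise_def)
  moreover have "M' - {e} \<subseteq> edges G" using M'(1) by blast
  ultimately have "M' - {e} = M" using uniquely_restrictedD[OF M] by simp
  then show "M' = insert e M" using \<open>e \<in> M'\<close> by blast
qed

lemma pairwise_disjnt_insert2:
  assumes "disjnt a b" "\<And>f. f \<in> R \<Longrightarrow> disjnt a f" "\<And>f. f \<in> R \<Longrightarrow> disjnt b f" "pairwise disjnt R"
  shows "pairwise disjnt (insert a (insert b R))"
  using assms unfolding pairwise_insert by (auto dest: disjnt_sym)

text \<open>Switching the two matching edges of an alternating 4-cycle \<open>u v y x\<close> gives a second perfect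
matching on the same vertices.\<close>

lemma not_uniquely_restricted_square:
  assumes M: "{u, v} \<in> M" "{x, y} \<in> M" "{u, v} \<noteq> {x, y}"
    and e: "{u, x} \<in> edges G" "{v, y} \<in> edges G"
    and ne: "u \<noteq> v" "x \<noteq> y"
  shows "\<not> uniquely_restricted G M"
proof
  assume ur: "uniquely_restricted G M"
  then have disj: "pairwise disjnt M" and sub: "M \<subseteq> edges G"
    by (simp_all add: uniquely_restricted_iff)
  have d: "disjnt {u, v} {x, y}" using pairwiseD[OF disj M(1,2,3)] .
  define M' where "M' = insert {u, x} (insert {v, y} (M - {{u, v}, {x, y}}))"
  have off: "disjnt f {u, v, x, y}" if "f \<in> M - {{u, v}, {x, y}}" for f
    using pairwiseD[OF disj, of f "{u, v}"] pairwiseD[OF disj, of f "{x, y}"] that M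
    by (auto simp: disjnt_iff)
  have "disjnt {u, x} {v, y}" using d ne by auto
  moreover have "disjnt {u, x} f" "disjnt {v, y} f" if "f \<in> M - {{u, v}, {x, y}}" for f
    using off[OF that] by auto
  moreover have "pairwise disjnt (M - {{u, v}, {x, y}})"
    using disj by (rule pairwise_subset) blast
  ultimately have "pairwise disjnt M'"
    unfolding M'_def by (rule pairwise_disjnt_insert2)
  moreover have "\<Union>M' = \<Union>M" using M unfolding M'_def by auto
  moreover have "M' \<subseteq> edges G" using e sub unfolding M'_def by auto
  ultimately have "M' = M" using uniquely_restrictedD[OF ur] by simp
  then have "{u, x} \<in> M" unfolding M'_def by auto
  then show False
    using pairwiseD[OF disj, of "{u, x}" "{u, v}"] M d by (auto simp: disjnt_iff doubleton_eq_iff)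
qed

text \<open>Being semistrong depends only on the edges and their incidences; the numbers of isolated vertices of
\<open>G\<close> and \<open>H\<close> may differ.\<close>

lemma semistrong_image_iff:
  assumes inj: "inj_on f (\<Union>(edges G))" and H: "edges H = (`) f ` edges G" and M: "M \<subseteq> edges G"
  shows "semistrong H ((`) f ` M) \<longleftrightarrow> semistrong G M"
proof -
  have sub: "e \<subseteq> \<Union>(edges G)" if "e \<in> edges G" for e using that by blast
  have "\<Union>M \<subseteq> \<Union>(edges G)" using M by blast
  have eq: "f ` e = f ` e' \<longleftrightarrow> e = e'" if "e \<in> edges G" "e' \<in> edges G" for e e'
    using inj_on_image_eq_iff[OF inj] sub that by blast
  have disj: "pairwise disjnt ((`) f ` M) \<longleftrightarrow> pairwise disjnt M"
  proof -
    have "(f ` e \<noteq> f ` e' \<longrightarrow> disjnt (f ` e) (f ` e')) \<longleftrightarrow> (e \<noteq> e' \<longrightarrow> disjnt e e')"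
      if "e \<in> M" "e' \<in> M" for e e'
      using that M eq[of e e'] disjnt_inj_on_iff[OF inj, of e e'] by (simp add: subset_iff)
    then show ?thesis unfolding pairwise_def ball_simps by (intro ball_cong refl) simp
  qed
  have pendant: "(\<exists>v\<in>f ` e. \<forall>g\<in>edges H. g \<subseteq> \<Union>((`) f ` M) \<longrightarrow> v \<in> g \<longrightarrow> g = f ` e) \<longleftrightarrow>
      (\<exists>v\<in>e. \<forall>g\<in>edges G. g \<subseteq> \<Union>M \<longrightarrow> v \<in> g \<longrightarrow> g = e)" if e: "e \<in> M" for e
  proof -
    have eG: "e \<in> edges G" using e M by blast
    have "(f ` g \<subseteq> \<Union>((`) f ` M) \<longrightarrow> f v \<in> f ` g \<longrightarrow> f ` g = f ` e) \<longleftrightarrow>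
        (g \<subseteq> \<Union>M \<longrightarrow> v \<in> g \<longrightarrow> g = e)" if "v \<in> e" "g \<in> edges G" for v g
    proof -
      have "f ` g \<subseteq> \<Union>((`) f ` M) \<longleftrightarrow> g \<subseteq> \<Union>M"
        unfolding image_Union[symmetric]
        using inj_on_image_subset_iff[OF inj sub[OF that(2)] \<open>\<Union>M \<subseteq> \<Union>(edges G)\<close>] .
      moreover have "f v \<in> f ` g \<longleftrightarrow> v \<in> g"
        using inj_on_image_mem_iff[OF inj _ sub[OF that(2)], of v] that(1) eG by blast
      ultimately show ?thesis using eq[OF that(2) eG] by simp
    qed
    then show ?thesis unfolding H by simp
  qed
  have "(`) f ` M \<subseteq> edges H" using M unfolding H by blast
  then show ?thesis unfolding semistrong_iff using M disj pendant by simp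
qed

section \<open>Colorings through an indexing of the edges\<close>

text \<open>Sets of vertices are awkward arguments for a coloring. An injective enumeration \<open>E\<close> of the edges
allows colorings to be defined and analyzed on the indices. \<open>P\<close> stands for either kind of matching.\<close>

lemma coloring_indexed:
  assumes E: "bij_betw E I (edges G)"
  shows "(\<exists>c. (\<forall>i. P {e \<in> edges G. c e = i}) \<and> c ` edges G \<subseteq> K) \<longleftrightarrow>
         (\<exists>x. (\<forall>i. P (E ` {a \<in> I. x a = i})) \<and> x ` I \<subseteq> K)"
    (is "(\<exists>c. ?C c) \<longleftrightarrow> (\<exists>x. ?X x)")
proof -
  have edges: "edges G = E ` I" using E by (simp add: bij_betw_def)
  have key: "?C c \<longleftrightarrow> ?X x" if "\<And>a. a \<in> I \<Longrightarrow> c (E a) = x a" for c x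
  proof -
    have "{e \<in> edges G. c e = i} = E ` {a \<in> I. x a = i}" for i
      unfolding edges using that by auto
    moreover have "c ` edges G = x ` I"
      unfolding edges image_image using that by simp
    ultimately show ?thesis by simp
  qed
  show ?thesis
  proof
    assume "\<exists>c. ?C c"
    then obtain c where "?C c" ..
    then have "?X (\<lambda>a. c (E a))" using key[of c "\<lambda>a. c (E a)"] by simp
    then show "\<exists>x. ?X x" by (rule exI[of ?X "\<lambda>a. c (E a)"])
  next
    assume "\<exists>x. ?X x"
    then obtain x where "?X x" ..
    moreover have "x (inv_into I E (E a)) = x a" if "a \<in> I" for a
      using that bij_betw_inv_into_left[OF E] by simp
    ultimately have "?C (\<lambda>e. x (inv_into I E e))"
      using key[of "\<lambda>e. x (inv_into I E e)" x] by simp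
    then show "\<exists>c. ?C c" by (rule exI[of ?C "\<lambda>e. x (inv_into I E e)"])
  qed
qed

lemma chromatic_index_eqI:
  fixes k :: nat
  assumes E: "bij_betw E I (edges G)"
    and x: "\<And>i. P (E ` {a \<in> I. x a = i})" "x ` I \<subseteq> {..<k}"
    and least: "\<And>x l. (\<And>i. P (E ` {a \<in> I. x a = i})) \<Longrightarrow> x ` I \<subseteq> {..<l} \<Longrightarrow> k \<le> l"
  shows "(LEAST k. \<exists>c. (\<forall>i. P {e \<in> edges G. c e = i}) \<and> c ` edges G \<subseteq> {..<k}) = k"
  unfolding coloring_indexed[OF E]
proof (rule Least_equality)
  show "\<exists>x. (\<forall>i. P (E ` {a \<in> I. x a = i})) \<and> x ` I \<subseteq> {..<k}"
    using x by (intro exI[of _ x] conjI allI)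
next
  fix l :: nat
  assume "\<exists>x. (\<forall>i. P (E ` {a \<in> I. x a = i})) \<and> x ` I \<subseteq> {..<l}"
  then obtain x where "\<forall>i. P (E ` {a \<in> I. x a = i})" "x ` I \<subseteq> {..<l}" by (elim exE conjE)
  then show "k \<le> l" using least[of x l] by simp
qed

lemma ur_chromatic_index_eqI:
  assumes "bij_betw E I (edges G)"
    and "\<And>i. uniquely_restricted G (E ` {a \<in> I. x a = i})" "x ` I \<subseteq> {..<k}"
    and "\<And>x l. (\<And>i. uniquely_restricted G (E ` {a \<in> I. x a = i})) \<Longrightarrow> x ` I \<subseteq> {..<l} \<Longrightarrow> k \<le> l"
  shows "ur_chromatic_index G = k"
  unfolding ur_chromatic_index_def ur_edge_coloring_def
  by (rule chromatic_index_eqI[where P = "uniquely_restricted G", OF assms])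

lemma ss_chromatic_index_eqI:
  assumes "bij_betw E I (edges G)"
    and "\<And>i. semistrong G (E ` {a \<in> I. x a = i})" "x ` I \<subseteq> {..<k}"
    and "\<And>x l. (\<And>i. semistrong G (E ` {a \<in> I. x a = i})) \<Longrightarrow> x ` I \<subseteq> {..<l} \<Longrightarrow> k \<le> l"
  shows "ss_chromatic_index G = k"
  unfolding ss_chromatic_index_def ss_edge_coloring_def
  by (rule chromatic_index_eqI[where P = "semistrong G", OF assms])

lemma ss_chromatic_index_image:
  assumes inj: "inj_on f (\<Union>(edges G))" and H: "edges H = (`) f ` edges G"
  shows "ss_chromatic_index H = ss_chromatic_index G"
proof -
  have bij: "bij_betw ((`) f) (edges G) (edges H)"
    unfolding bij_betw_def H
    using inj_on_subset[OF inj_on_image_Pow[OF inj]] by blast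
  have "semistrong H ((`) f ` {e \<in> edges G. x e = i}) \<longleftrightarrow> semistrong G {e \<in> edges G. x e = i}"
    for x :: "_ \<Rightarrow> nat" and i
    by (rule semistrong_image_iff[OF inj H]) blast
  then show ?thesis
    unfolding ss_chromatic_index_def ss_edge_coloring_def coloring_indexed[OF bij] by simp
qed

section \<open>The double wheel\<close>

abbreviation double_wheel :: "nat \<Rightarrow> (nat + nat) graph" where
  "double_wheel n \<equiv> graph_join (cycle_graph n) (independent_graph 2)"

text \<open>The successor on the cycle. Working with \<open>nxt\<close> and its injectivity keeps modular arithmetic out of
the structural arguments.\<close>

definition nxt :: "nat \<Rightarrow> nat \<Rightarrow> nat" where
  "nxt n i = Suc i mod n"

lemma nxt_if: "i < n \<Longrightarrow> nxt n i = (if Suc i = n then 0 else Suc i)"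
  by (auto simp: nxt_def)

lemma nxt_less: "i < n \<Longrightarrow> nxt n i < n"
  by (simp add: nxt_def)

lemma nxt_eq_iff: "i < n \<Longrightarrow> j < n \<Longrightarrow> nxt n i = nxt n j \<longleftrightarrow> i = j"
  by (auto simp: nxt_if split: if_splits)

lemma nxt_neq: "2 \<le> n \<Longrightarrow> i < n \<Longrightarrow> nxt n i \<noteq> i"
  by (auto simp: nxt_if)

lemma nxt_nxt_neq: "3 \<le> n \<Longrightarrow> i < n \<Longrightarrow> nxt n (nxt n i) \<noteq> i"
  by (auto simp: nxt_if nxt_less split: if_splits)

lemma nxt_surj: "i < n \<Longrightarrow> \<exists>j<n. nxt n j = i"
  by (rule exI[of _ "if i = 0 then n - 1 else i - 1"]) (auto simp: nxt_def)

text \<open>Edges of the double wheel by index: \<open>Inl j\<close> names the rim edge that leaves \<open>j\<close>, and \<open>Inr (i, t)\<close> the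
spoke between the rim vertex \<open>i\<close> and the hub \<open>t\<close>.\<close>

fun dw_edge :: "nat \<Rightarrow> nat + nat \<times> nat \<Rightarrow> (nat + nat) set" where
  "dw_edge n (Inl j) = {Inl j, Inl (nxt n j)}"
| "dw_edge n (Inr (i, t)) = {Inl i, Inr t}"

definition dw_index :: "nat \<Rightarrow> (nat + nat \<times> nat) set" where
  "dw_index n = {..<n} <+> {..<n} \<times> {..<2}"

lemma dw_index_iff [simp]:
  "Inl j \<in> dw_index n \<longleftrightarrow> j < n" "Inr (i, t) \<in> dw_index n \<longleftrightarrow> i < n \<and> t < 2"
  by (auto simp: dw_index_def)

lemma dw_index_cases:
  assumes "a \<in> dw_index n"
  obtains j where "a = Inl j" "j < n" | i t where "a = Inr (i, t)" "i < n" "t < 2"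
  using assms by (auto simp: dw_index_def)

lemma bij_dw_edge:
  assumes "3 \<le> n"
  shows "bij_betw (dw_edge n) (dw_index n) (edges (double_wheel n))"
proof (rule bij_betw_imageI)
  show "inj_on (dw_edge n) (dw_index n)"
  proof (rule inj_onI)
    fix a b assume "a \<in> dw_index n" "b \<in> dw_index n" "dw_edge n a = dw_edge n b"
    then show "a = b"
      using assms nxt_nxt_neq[of n]
      by (elim dw_index_cases) (auto simp: doubleton_eq_iff nxt_less)
  qed
  have "edges (cycle_graph n) = (\<lambda>j. {j, nxt n j}) ` {..<n}"
    by (auto simp: cycle_graph_def nxt_def)
  then have rim: "(`) Inl ` edges (cycle_graph n) = (\<lambda>j. dw_edge n (Inl j)) ` {..<n}"
    by (simp add: image_image)
  have spokes: "{{Inl u, Inr v} | u v. u < n \<and> v < (2::nat)} =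
      (\<lambda>p. dw_edge n (Inr p)) ` ({..<n} \<times> {..<2})" (is "?L = ?R")
  proof (intro equalityI subsetI)
    fix e assume "e \<in> ?L"
    then obtain u v where "e = {Inl u, Inr v}" "u < n" "v < 2" by blast
    then show "e \<in> ?R" by (intro image_eqI[of _ _ "(u, v)"]) simp_all
  next
    fix e assume "e \<in> ?R"
    then obtain p where p: "e = dw_edge n (Inr p)" "p \<in> {..<n} \<times> {..<2}" ..
    obtain u v where "p = (u, v)" by (cases p)
    with p have "e = {Inl u, Inr v}" "u < n" "v < 2" by simp_all
    then show "e \<in> ?L" by blast
  qed
  show "dw_edge n ` dw_index n = edges (double_wheel n)"
    unfolding dw_index_def Plus_def image_Un image_image
    by (simp only: rim[symmetric] spokes[symmetric])
      (simp add: graph_join_def independent_graph_def, simp add: cycle_graph_def)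
qed

lemma dw_edge_in: "3 \<le> n \<Longrightarrow> a \<in> dw_index n \<Longrightarrow> dw_edge n a \<in> edges (double_wheel n)"
  using bij_dw_edge by (auto simp: bij_betw_def)

lemma edge_cases:
  assumes "3 \<le> n" "f \<in> edges (double_wheel n)"
  obtains j where "f = dw_edge n (Inl j)" "j < n"
    | i t where "f = dw_edge n (Inr (i, t))" "i < n" "t < 2"
proof -
  have "f \<in> dw_edge n ` dw_index n"
    using assms(2) bij_betw_imp_surj_on[OF bij_dw_edge[OF assms(1)]] by simp
  then obtain a where "f = dw_edge n a" "a \<in> dw_index n" ..
  with that show thesis by (elim dw_index_cases) simp_all
qed

lemma rim_in: "3 \<le> n \<Longrightarrow> j < n \<Longrightarrow> {Inl j, Inl (nxt n j)} \<in> edges (double_wheel n)"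
  using dw_edge_in[of n "Inl j"] by simp

lemma spoke_in: "3 \<le> n \<Longrightarrow> i < n \<Longrightarrow> t < 2 \<Longrightarrow> {Inl i, Inr t} \<in> edges (double_wheel n)"
  using dw_edge_in[of n "Inr (i, t)"] by simp

lemma card_edge:
  assumes "3 \<le> n" "e \<in> edges (double_wheel n)"
  shows "card e = 2"
  using assms(2)
proof (rule edge_cases[OF assms(1)])
  fix j assume "e = dw_edge n (Inl j)" "j < n"
  then show ?thesis using nxt_neq[of n j] assms(1) by simp
qed simp

lemma empty_not_edge: "3 \<le> n \<Longrightarrow> {} \<notin> edges (double_wheel n)"
  using card_edge[of n "{}"] by auto

lemma semistrong_single_edge:
  assumes "3 \<le> n" "e \<in> edges (double_wheel n)"
  shows "semistrong (double_wheel n) {e}"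
proof (rule semistrong_singleton[OF assms(2)])
  have e: "card e = 2" using card_edge[OF assms] .
  then show "e \<noteq> {}" by auto
  fix f assume "f \<in> edges (double_wheel n)" "f \<subseteq> e"
  then show "f = e" using e card_edge[OF assms(1)] by (intro card_subset_eq) (auto intro: card_ge_0_finite)
qed

lemma dw_disjoint_eq:
  assumes "3 \<le> n" and disj: "pairwise disjnt (dw_edge n ` S)"
    and S: "S \<subseteq> dw_index n" "a \<in> S" "b \<in> S" and meet: "v \<in> dw_edge n a" "v \<in> dw_edge n b"
  shows "a = b"
proof (rule ccontr)
  assume "a \<noteq> b"
  then have "dw_edge n a \<noteq> dw_edge n b"
    using inj_onD[OF bij_betw_imp_inj_on[OF bij_dw_edge[OF assms(1)]], of a b] S by blast
  then have "disjnt (dw_edge n a) (dw_edge n b)"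
    using pairwiseD[OF disj] S(2,3) by simp
  then show False using meet by (auto simp: disjnt_iff)
qed

section \<open>Semistrong matchings of the double wheel\<close>

text \<open>Sets of rim edges with the two forbidden patterns excluded are semistrong. For a member \<open>j\<close>, one of
\<open>j - 2\<close> and \<open>j + 2\<close> is missing. As \<open>j - 1\<close> and \<open>j + 1\<close> are missing too, the end of the edge on that
side has its partner as its only covered neighbor; the hubs are not covered at all.\<close>

lemma semistrong_rim:
  assumes n: "3 \<le> n" and S: "S \<subseteq> {..<n}"
    and consec: "\<And>j. j \<in> S \<Longrightarrow> nxt n j \<notin> S"
    and triple: "\<And>j. j \<in> S \<Longrightarrow> nxt n (nxt n j) \<in> S \<Longrightarrow> nxt n (nxt n (nxt n (nxt n j))) \<notin> S"
  shows "semistrong (double_wheel n) (dw_edge n ` Inl ` S)"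
  unfolding semistrong_iff
proof (intro conjI ballI)
  let ?M = "dw_edge n ` Inl ` S"
  have less: "j < n" if "j \<in> S" for j using that S by blast
  show "?M \<subseteq> edges (double_wheel n)" using rim_in[OF n] less by auto
  show "pairwise disjnt ?M"
    unfolding pairwise_image
  proof (rule pairwiseI, intro impI)
    fix j k assume jk: "j \<in> S" "k \<in> S" "j \<noteq> k"
    have "nxt n j \<noteq> k" "nxt n k \<noteq> j" using consec jk by auto
    moreover have "nxt n j \<noteq> nxt n k" using nxt_eq_iff less jk by simp
    ultimately show "disjnt (dw_edge n (Inl j)) (dw_edge n (Inl k))" using jk by simp
  qed
  have covered: "i \<in> S \<or> (\<exists>k\<in>S. i = nxt n k)" if "Inl i \<in> \<Union>?M" for i
    using that by auto
  have hub: "Inr t \<notin> \<Union>?M" for t by auto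
  fix e assume "e \<in> ?M"
  then obtain j where j: "e = dw_edge n (Inl j)" "j \<in> S" by blast
  \<comment> \<open>\<open>p\<close> and \<open>q\<close> are the rim edges \<open>j - 1\<close> and \<open>j - 2\<close>.\<close>
  obtain p where p: "p < n" "nxt n p = j" using nxt_surj[OF less[OF j(2)]] by blast
  obtain q where q: "q < n" "nxt n q = p" using nxt_surj[OF p(1)] by blast
  show "\<exists>v\<in>e. \<forall>f\<in>edges (double_wheel n). f \<subseteq> \<Union>?M \<longrightarrow> v \<in> f \<longrightarrow> f = e"
  proof (cases "q \<in> S")
    case False
    have "f = e" if "f \<in> edges (double_wheel n)" and f: "f \<subseteq> \<Union>?M" "Inl j \<in> f" for f
      using that(1)
    proof (rule edge_cases[OF n])
      fix k assume k: "f = dw_edge n (Inl k)" "k < n"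
      show "f = e"
      proof (cases "k = j")
        case True then show ?thesis using k j by simp
      next
        case False
        then have "nxt n k = nxt n p" using f(2) k p by auto
        then have "k = p" using nxt_eq_iff k p by blast
        then have "Inl p \<in> \<Union>?M" using f(1) k by auto
        then consider "p \<in> S" | k' where "k' \<in> S" "nxt n q = nxt n k'" using covered q by blast
        then show ?thesis
        proof cases
          case 1 then show ?thesis using consec[of p] p j by simp
        next
          case 2 then show ?thesis using nxt_eq_iff[OF q(1)] less \<open>q \<notin> S\<close> by auto
        qed
      qed
    next
      fix i t assume "f = dw_edge n (Inr (i, t))"
      then show "f = e" using f(1) hub by auto
    qed
    then show ?thesis using j by (intro bexI[of _ "Inl j"]) simp_all
  next
    case True
    let ?k = "nxt n j"
    have out: "nxt n ?k \<notin> S" using triple[OF True] q p j by simp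
    have "f = e" if "f \<in> edges (double_wheel n)" and f: "f \<subseteq> \<Union>?M" "Inl ?k \<in> f" for f
      using that(1)
    proof (rule edge_cases[OF n])
      fix k assume k: "f = dw_edge n (Inl k)" "k < n"
      show "f = e"
      proof (cases "nxt n k = ?k")
        case True then show ?thesis using k j nxt_eq_iff less by auto
      next
        case False
        then have "k = ?k" using f(2) k by auto
        then have "Inl (nxt n ?k) \<in> \<Union>?M" using f(1) k by auto
        then obtain k' where k': "k' \<in> S" "nxt n ?k = nxt n k'" using covered out by blast
        then have "?k = k'" using nxt_eq_iff[of ?k n k'] less nxt_less j by simp
        then show ?thesis using k' consec[OF j(2)] by simp
      qed
    next
      fix i t assume "f = dw_edge n (Inr (i, t))"
      then show "f = e" using f(1) hub by auto
    qed
    then show ?thesis using j by (intro bexI[of _ "Inl ?k"]) simp_all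
  qed
qed

lemma semistrong_pendant_vertex:
  assumes ss: "semistrong (double_wheel n) (dw_edge n ` S)" and "a \<in> S"
  obtains v where "v \<in> dw_edge n a"
    "\<And>f. f \<in> edges (double_wheel n) \<Longrightarrow> f \<subseteq> \<Union>(dw_edge n ` S) \<Longrightarrow> v \<in> f \<Longrightarrow> f = dw_edge n a"
proof -
  have "\<exists>v\<in>dw_edge n a. \<forall>f\<in>edges (double_wheel n). f \<subseteq> \<Union>(dw_edge n ` S) \<longrightarrow> v \<in> f \<longrightarrow> f = dw_edge n a"
    using ss \<open>a \<in> S\<close> unfolding semistrong_iff by blast
  then show thesis using that by (elim bexE) simp
qed

text \<open>Let \<open>v\<close> be the end of \<open>b\<close> that has no covered neighbor besides its partner. A rim vertex \<open>v\<close> is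
adjacent to the covered hub \<open>t\<close>, and a hub \<open>v\<close> is adjacent to the covered rim vertex \<open>i\<close>. In
either case this edge must be \<open>b\<close>, so that \<open>b\<close> meets the given spoke and equals it.\<close>

lemma semistrong_spoke_alone:
  assumes n: "3 \<le> n" and ss: "semistrong (double_wheel n) (dw_edge n ` S)"
    and S: "S \<subseteq> dw_index n" and a: "Inr (i, t) \<in> S" and b: "b \<in> S"
  shows "b = Inr (i, t)"
proof -
  let ?V = "\<Union>(dw_edge n ` S)"
  have it: "i < n" "t < 2" using S a by (auto dest: subsetD)
  have V: "Inl i \<in> ?V" "Inr t \<in> ?V" using a by (auto intro: bexI[of _ "Inr (i, t)"])
  obtain v where v: "v \<in> dw_edge n b"
      "\<And>f. f \<in> edges (double_wheel n) \<Longrightarrow> f \<subseteq> ?V \<Longrightarrow> v \<in> f \<Longrightarrow> f = dw_edge n b"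
    by (rule semistrong_pendant_vertex[OF ss b]) blast
  have "v \<in> ?V" using v(1) b by blast
  have "b \<in> dw_index n" using S b by blast
  then show ?thesis
  proof (cases rule: dw_index_cases)
    case (1 j)
    then obtain k where k: "v = Inl k" "k < n" using v(1) nxt_less by auto
    have "{Inl k, Inr t} = dw_edge n b"
      using spoke_in[OF n k(2) it(2)] V \<open>v \<in> ?V\<close> k(1) by (intro v(2)) auto
    then show ?thesis using 1 by auto
  next
    case (2 k s)
    then consider "v = Inl k" | "v = Inr s" using v(1) by auto
    then have "k = i \<or> s = t"
    proof cases
      case 1
      have "{Inl k, Inr t} = dw_edge n b"
        using spoke_in[OF n 2(2) it(2)] V \<open>v \<in> ?V\<close> 1 by (intro v(2)) auto
      then show ?thesis using 2 by (auto simp: doubleton_eq_iff)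
    next
      case hub: 2
      have "{Inl i, Inr s} = dw_edge n b"
        using spoke_in[OF n it(1) 2(3)] V \<open>v \<in> ?V\<close> hub by (intro v(2)) auto
      then show ?thesis using 2 by (auto simp: doubleton_eq_iff)
    qed
    then show ?thesis
      using dw_disjoint_eq[OF n semistrong_disjoint[OF ss] S a b, of "Inl i"]
        dw_disjoint_eq[OF n semistrong_disjoint[OF ss] S a b, of "Inr t"] 2 by auto
  qed
qed

lemma semistrong_rim_nxt:
  assumes n: "3 \<le> n" and ss: "semistrong (double_wheel n) (dw_edge n ` S)"
    and S: "S \<subseteq> dw_index n" and j: "Inl j \<in> S"
  shows "Inl (nxt n j) \<notin> S"
proof
  assume k: "Inl (nxt n j) \<in> S"
  have "j < n" using S j by (auto dest: subsetD)
  have "Inl j = (Inl (nxt n j) :: nat + nat \<times> nat)"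
    using dw_disjoint_eq[OF n semistrong_disjoint[OF ss] S j k, of "Inl (nxt n j)"] by simp
  then show False using nxt_neq[of n j] \<open>j < n\<close> n by simp
qed

text \<open>If the rim edges \<open>j\<close>, \<open>j + 2\<close> and \<open>j + 4\<close> are all present, the edge \<open>j + 2\<close> is not pendant: both its
neighbors \<open>j + 1\<close> and \<open>j + 3\<close> on the rim join covered vertices. Indices are modulo \<open>n\<close>, so for
\<open>n = 4\<close> the edges \<open>j\<close> and \<open>j + 4\<close> coincide and the lemma forbids opposite edges.\<close>

lemma semistrong_rim_triple:
  assumes n: "3 \<le> n" and ss: "semistrong (double_wheel n) (dw_edge n ` S)"
    and S: "S \<subseteq> dw_index n" and j: "Inl j \<in> S" "Inl (nxt n (nxt n j)) \<in> S"
  shows "Inl (nxt n (nxt n (nxt n (nxt n j)))) \<notin> S"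
proof
  define p where "p = nxt n j"
  define k where "k = nxt n p"
  assume "Inl (nxt n (nxt n (nxt n (nxt n j)))) \<in> S"
  then have in_S: "Inl j \<in> S" "Inl k \<in> S" "Inl (nxt n (nxt n k)) \<in> S"
    using j by (simp_all add: p_def k_def)
  let ?V = "\<Union>(dw_edge n ` S)"
  have less: "j < n" "p < n" "k < n" "nxt n k < n"
    using S j(1) by (auto dest: subsetD simp: p_def k_def nxt_less)
  have "Inl p \<in> ?V"
    using in_S(1) by (intro UN_I[of "Inl j"]) (simp_all add: p_def)
  moreover have "Inl k \<in> ?V" "Inl (nxt n k) \<in> ?V"
    using in_S(2) by (intro UN_I[of "Inl k"]; simp)+
  moreover have "Inl (nxt n (nxt n k)) \<in> ?V"
    using in_S(3) by (intro UN_I[of "Inl (nxt n (nxt n k))"]) simp_all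
  ultimately have V: "dw_edge n (Inl p) \<subseteq> ?V" "dw_edge n (Inl (nxt n k)) \<subseteq> ?V"
    by (simp_all add: k_def)
  have inj: "x = y" if "dw_edge n (Inl x) = dw_edge n (Inl y)" "x < n" "y < n" for x y
    using inj_onD[OF bij_betw_imp_inj_on[OF bij_dw_edge[OF n]] that(1)] that by simp
  obtain v where v: "v \<in> dw_edge n (Inl k)"
      "\<And>f. f \<in> edges (double_wheel n) \<Longrightarrow> f \<subseteq> ?V \<Longrightarrow> v \<in> f \<Longrightarrow> f = dw_edge n (Inl k)"
    by (rule semistrong_pendant_vertex[OF ss in_S(2)]) blast
  from v(1) consider "v = Inl k" | "v = Inl (nxt n k)" by auto
  then show False
  proof cases
    case 1
    have "dw_edge n (Inl p) = dw_edge n (Inl k)"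
      using dw_edge_in[OF n, of "Inl p"] V less 1 by (intro v(2)) (simp_all add: k_def)
    then show False using inj[of p k] less nxt_neq[of n p] n by (simp add: k_def)
  next
    case 2
    have "dw_edge n (Inl (nxt n k)) = dw_edge n (Inl k)"
      using dw_edge_in[OF n, of "Inl (nxt n k)"] V less 2 by (intro v(2)) simp_all
    then show False using inj[of "nxt n k" k] less nxt_neq[of n k] n by simp
  qed
qed

section \<open>The semistrong chromatic index\<close>

text \<open>The colorings of the rim all of whose classes are semistrong.\<close>

definition rim_coloring :: "nat \<Rightarrow> (nat \<Rightarrow> nat) \<Rightarrow> bool" where
  "rim_coloring n y \<longleftrightarrow> (\<forall>j<n. y (nxt n j) \<noteq> y j \<and>
     \<not> (y (nxt n (nxt n j)) = y j \<and> y (nxt n (nxt n (nxt n (nxt n j)))) = y j))"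

text \<open>The number \<open>i + n * t\<close> is used as the color of the spoke \<open>Inr (i, t)\<close>; over \<open>i < n\<close> and \<open>t < 2\<close> these
are exactly the numbers below \<open>2n\<close>.\<close>

lemma spoke_color_eq_iff:
  fixes n :: nat
  assumes "i < n" "k < n"
  shows "i + n * t = k + n * s \<longleftrightarrow> i = k \<and> t = s"
proof
  assume *: "i + n * t = k + n * s"
  have "(i + n * t) mod n = i" "(k + n * s) mod n = k" using assms by simp_all
  with * have "i = k" by simp
  with * assms show "i = k \<and> t = s" by simp
qed simp

lemma spoke_color_less:
  fixes n :: nat
  assumes "i < n" "t < 2"
  shows "i + n * t < 2 * n"
proof -
  have "n * t \<le> n * 1" using assms by (intro mult_le_mono) simp_all
  with assms(1) show ?thesis by linarith
qed

text \<open>Since spokes are alone in their classes, the problem splits: \<open>2n\<close> private colors for the spokes and,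
independently, a coloring of the rim with as few colors as possible.\<close>

lemma ss_chromatic_index_double_wheel_eqI:
  assumes n: "3 \<le> n"
    and y: "rim_coloring n y" "y ` {..<n} \<subseteq> {..<r}"
    and least: "\<And>z. rim_coloring n z \<Longrightarrow> r \<le> card (z ` {..<n})"
  shows "ss_chromatic_index (double_wheel n) = 2 * n + r"
proof (rule ss_chromatic_index_eqI[OF bij_dw_edge[OF n]])
  define x where "x = case_sum y (\<lambda>(i, t). r + (i + n * t))"
  have x_simps [simp]: "x (Inl j) = y j" "x (Inr (i, t)) = r + (i + n * t)" for i j t
    by (simp_all add: x_def)
  have y_less: "y j < r" if "j < n" for j using y(2) that by auto
  fix c
  let ?S = "{a \<in> dw_index n. x a = c}"
  show "semistrong (double_wheel n) (dw_edge n ` ?S)"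
  proof (cases "\<exists>i t. Inr (i, t) \<in> ?S")
    case True
    then obtain i t where it: "Inr (i, t) \<in> ?S" by blast
    have "a = Inr (i, t)" if a: "a \<in> ?S" for a
    proof -
      have "a \<in> dw_index n" "x a = x (Inr (i, t))" "i < n" using a it by simp_all
      from this(1) show ?thesis
      proof (cases rule: dw_index_cases)
        case (1 j)
        then show ?thesis using y_less[of j] \<open>x a = _\<close> by simp
      next
        case (2 k s)
        then show ?thesis using \<open>x a = _\<close> \<open>i < n\<close> spoke_color_eq_iff[of k n i s t] by simp
      qed
    qed
    with it have "?S = {Inr (i, t)}" by blast
    then have "dw_edge n ` ?S = {dw_edge n (Inr (i, t))}" by simp
    then show ?thesis using semistrong_single_edge[OF n] dw_edge_in[OF n, of "Inr (i, t)"] it by simp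
  next
    case False
    define J where "J = {j. j < n \<and> y j = c}"
    have "?S = Inl ` J"
    proof (intro equalityI subsetI)
      fix a assume a: "a \<in> ?S"
      then have "a \<in> dw_index n" by simp
      then show "a \<in> Inl ` J"
        using a False by (cases rule: dw_index_cases) (auto simp: J_def)
    next
      fix a :: "nat + nat \<times> nat" assume "a \<in> Inl ` J"
      then show "a \<in> ?S" by (auto simp: J_def)
    qed
    moreover have "semistrong (double_wheel n) (dw_edge n ` Inl ` J)"
    proof (rule semistrong_rim[OF n])
      show "J \<subseteq> {..<n}" by (auto simp: J_def)
      show "nxt n j \<notin> J" if "j \<in> J" for j
        using y(1) that unfolding rim_coloring_def J_def by auto
      show "nxt n (nxt n (nxt n (nxt n j))) \<notin> J" if "j \<in> J" "nxt n (nxt n j) \<in> J" for j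
        using y(1) that unfolding rim_coloring_def J_def by auto
    qed
    ultimately show ?thesis by simp
  qed
  show "x ` dw_index n \<subseteq> {..<2 * n + r}"
  proof
    fix c assume "c \<in> x ` dw_index n"
    then obtain a where a: "c = x a" "a \<in> dw_index n" ..
    from a(2) show "c \<in> {..<2 * n + r}"
    proof (cases rule: dw_index_cases)
      case (1 j)
      then show ?thesis using a y_less[of j] by simp
    next
      case (2 i t)
      then show ?thesis using a spoke_color_less[of i n t] by simp
    qed
  qed
next
  fix x :: "nat + nat \<times> nat \<Rightarrow> nat" and l
  assume ss: "\<And>c. semistrong (double_wheel n) (dw_edge n ` {a \<in> dw_index n. x a = c})"
    and x: "x ` dw_index n \<subseteq> {..<l}"
  define Sp where "Sp = (Inr ` ({..<n} \<times> {..<2}) :: (nat + nat \<times> nat) set)"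
  define R where "R = (Inl ` {..<n} :: (nat + nat \<times> nat) set)"
  have sub: "Sp \<subseteq> dw_index n" "R \<subseteq> dw_index n" by (auto simp: Sp_def R_def)
  have alone: "b = a" if ab: "a \<in> Sp" "b \<in> dw_index n" "x b = x a" for a b
  proof -
    obtain i t where a: "a = Inr (i, t)" using ab(1) by (auto simp: Sp_def)
    have "a \<in> dw_index n" using ab(1) sub by blast
    then show ?thesis
      using semistrong_spoke_alone[OF n ss[of "x a"], of i t b] ab a by simp
  qed
  have "inj_on x Sp"
  proof (rule inj_onI)
    fix a b assume "a \<in> Sp" "b \<in> Sp" "x a = x b"
    then show "a = b" using alone[of b a] sub by blast
  qed
  then have "card (x ` Sp) = 2 * n"
    by (simp add: card_image Sp_def card_cartesian_product inj_on_def)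
  moreover have "x ` Sp \<inter> x ` R = {}"
  proof (rule ccontr)
    assume "x ` Sp \<inter> x ` R \<noteq> {}"
    then obtain c where "c \<in> x ` Sp" "c \<in> x ` R" by blast
    then obtain a b where ab: "a \<in> Sp" "b \<in> R" "x b = x a" by (elim imageE) simp
    then have "b = a" using alone[of a b] sub by blast
    then show False using ab by (auto simp: Sp_def R_def)
  qed
  moreover have "r \<le> card (x ` R)"
  proof -
    have "rim_coloring n (x \<circ> Inl)"
      unfolding rim_coloring_def
    proof (intro allI impI)
      fix j assume j: "j < n"
      let ?S = "{a \<in> dw_index n. x a = x (Inl j)}"
      have S: "?S \<subseteq> dw_index n" "Inl j \<in> ?S" using j by auto
      from semistrong_rim_nxt[OF n ss S] semistrong_rim_triple[OF n ss S]
      show "(x \<circ> Inl) (nxt n j) \<noteq> (x \<circ> Inl) j \<and>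
          \<not> ((x \<circ> Inl) (nxt n (nxt n j)) = (x \<circ> Inl) j \<and>
             (x \<circ> Inl) (nxt n (nxt n (nxt n (nxt n j)))) = (x \<circ> Inl) j)"
        using j by (simp add: nxt_less)
    qed
    from least[OF this] show ?thesis by (simp add: R_def image_comp)
  qed
  moreover have "card (x ` Sp \<union> x ` R) \<le> card {..<l}"
    using x sub by (intro card_mono) auto
  moreover have "card (x ` Sp \<union> x ` R) = card (x ` Sp) + card (x ` R)"
    using calculation(2) sub by (intro card_Un_disjoint) (auto simp: Sp_def R_def)
  ultimately show "2 * n + r \<le> l" by simp
qed

text \<open>With two colors the rim edges \<open>0, ..., 4\<close> would alternate, and \<open>0, 2, 4\<close> would be monochromatic.\<close>

lemma rim_coloring_ge3:
  assumes n: "5 \<le> n" and y: "rim_coloring n y"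
  shows "3 \<le> card (y ` {..<n})"
proof -
  have ne: "y 1 \<noteq> y 0" "y 2 \<noteq> y 1" "y 3 \<noteq> y 2" "y 4 \<noteq> y 3" and tr: "\<not> (y 2 = y 0 \<and> y 4 = y 0)"
    using y n unfolding rim_coloring_def
    by (auto simp: nxt_if eval_nat_numeral dest: spec[of _ 0] spec[of _ 1] spec[of _ 2] spec[of _ 3])
  have "\<exists>a b c. a < n \<and> b < n \<and> c < n \<and> card {y a, y b, y c} = 3"
  proof (cases "y 2 = y 0")
    case False
    then show ?thesis using ne n by (intro exI[of _ 0] exI[of _ 1] exI[of _ 2]) simp
  next
    case True
    then show ?thesis using ne n tr by (intro exI[of _ 2] exI[of _ 3] exI[of _ 4]) simp
  qed
  then obtain a b c where "a < n" "b < n" "c < n" "card {y a, y b, y c} = 3" by blast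
  then show ?thesis using card_mono[of "y ` {..<n}" "{y a, y b, y c}"] by simp
qed

lemma rim_coloring_ge4_cycle4:
  assumes y: "rim_coloring 4 y"
  shows "4 \<le> card (y ` {..<4})"
proof -
  have all: "\<forall>j\<in>{0,1,2,3}. y (nxt 4 j) \<noteq> y j \<and>
     \<not> (y (nxt 4 (nxt 4 j)) = y j \<and> y (nxt 4 (nxt 4 (nxt 4 (nxt 4 j)))) = y j)"
    using y by (simp add: rim_coloring_def)
  have "{..<4} = {0, 1, 2, 3::nat}" by auto
  moreover have "y 1 \<noteq> y 0" "y 2 \<noteq> y 1" "y 3 \<noteq> y 2" "y 0 \<noteq> y 3" "y 2 \<noteq> y 0" "y 3 \<noteq> y 1"
    using all by (simp_all add: nxt_def flip: numeral_2_eq_2)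
  ultimately show ?thesis by simp
qed

text \<open>A color class has at most two edges: three pairwise non-consecutive edges of a 7-cycle leave gaps
2, 2, 3, so they have the forbidden form \<open>j\<close>, \<open>j + 2\<close>, \<open>j + 4\<close>. Three colors thus cover at most six of
the seven edges.\<close>

lemma rim_coloring_ge4_cycle7:
  assumes y: "rim_coloring 7 y"
  shows "4 \<le> card (y ` {..<7})"
proof -
  have nxt: "nxt 7 0 = 1" "nxt 7 1 = 2" "nxt 7 2 = 3" "nxt 7 3 = 4" "nxt 7 4 = 5" "nxt 7 5 = 6" "nxt 7 6 = 0"
    by (simp_all add: nxt_def)
  have small: "card {j \<in> {..<7}. y j = c} \<le> 2" for c
  proof -
    define P where "P j \<longleftrightarrow> y j = c" for j
    have pair: "\<not> (P j \<and> P (nxt 7 j))"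
      and triple: "\<not> (P j \<and> P (nxt 7 (nxt 7 j)) \<and> P (nxt 7 (nxt 7 (nxt 7 (nxt 7 j)))))"
      if "j < 7" for j
    proof -
      have "y (nxt 7 j) \<noteq> y j"
        "\<not> (y (nxt 7 (nxt 7 j)) = y j \<and> y (nxt 7 (nxt 7 (nxt 7 (nxt 7 j)))) = y j)"
        using y that unfolding rim_coloring_def by simp_all
      then show "\<not> (P j \<and> P (nxt 7 j))"
        "\<not> (P j \<and> P (nxt 7 (nxt 7 j)) \<and> P (nxt 7 (nxt 7 (nxt 7 (nxt 7 j)))))"
        unfolding P_def by auto
    qed
    have "{..<7} = {0, 1, 2, 3, 4, 5, 6::nat}" by auto
    then have "card {j \<in> {..<7}. y j = c} = (\<Sum>j\<in>{0, 1, 2, 3, 4, 5, 6}. if P j then 1 else 0)"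
      by (simp add: sum.inter_filter[symmetric] P_def)
    also have "\<dots> = (if P 0 then 1 else 0) + ((if P 1 then 1 else 0) + ((if P 2 then 1 else 0) +
        ((if P 3 then 1 else 0) + ((if P 4 then 1 else 0) + ((if P 5 then 1 else 0) + (if P 6 then 1 else 0))))))"
      by (subst sum.insert; simp)+
    also have "\<dots> \<le> 2"
    proof -
      have "\<not> (P 0 \<and> P 1)" "\<not> (P 1 \<and> P 2)" "\<not> (P 2 \<and> P 3)" "\<not> (P 3 \<and> P 4)"
        "\<not> (P 4 \<and> P 5)" "\<not> (P 5 \<and> P 6)" "\<not> (P 6 \<and> P 0)"
        using pair[of 0] pair[of 1] pair[of 2] pair[of 3] pair[of 4] pair[of 5] pair[of 6]
        unfolding nxt by simp_all
      moreover have "\<not> (P 0 \<and> P 2 \<and> P 4)" "\<not> (P 1 \<and> P 3 \<and> P 5)" "\<not> (P 2 \<and> P 4 \<and> P 6)"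
        "\<not> (P 3 \<and> P 5 \<and> P 0)" "\<not> (P 4 \<and> P 6 \<and> P 1)" "\<not> (P 5 \<and> P 0 \<and> P 2)"
        "\<not> (P 6 \<and> P 1 \<and> P 3)"
        using triple[of 0] triple[of 1] triple[of 2] triple[of 3] triple[of 4] triple[of 5] triple[of 6]
        unfolding nxt by simp_all
      ultimately show ?thesis
        by (smt (verit) one_add_one add_0 add_0_right order_refl one_le_numeral zero_le)
    qed
    finally show ?thesis .
  qed
  have "7 = card (\<Union>c\<in>y ` {..<7}. {j \<in> {..<7}. y j = c})"
  proof -
    have "(\<Union>c\<in>y ` {..<7}. {j \<in> {..<7}. y j = c}) = {..<7}" by auto
    then show ?thesis by simp
  qed
  also have "\<dots> \<le> (\<Sum>c\<in>y ` {..<7}. card {j \<in> {..<7}. y j = c})"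
    by (intro card_UN_le) simp
  also have "\<dots> \<le> card (y ` {..<7}) * 2"
    using sum_bounded_above[of "y ` {..<7}" "\<lambda>c. card {j \<in> {..<7}. y j = c}" 2] small by simp
  finally show ?thesis by simp
qed

text \<open>An infinite word without forbidden patterns closes up around the cycle if it starts with \<open>01\<close> and its first
\<open>n\<close> letters end with \<open>012\<close>: no forbidden pattern can cross the seam.\<close>

lemma rim_coloringI:
  assumes n: "5 \<le> n"
    and step: "\<And>j. y (j + 1) \<noteq> y j"
    and inner: "\<And>j. \<not> (y (j + 2) = y j \<and> y (j + 4) = y j)"
    and ends: "y 0 = 0" "y 1 = 1" "y (n - 3) = 0" "y (n - 2) = 1" "y (n - 1) = 2"
  shows "rim_coloring n y"
  unfolding rim_coloring_def
proof (intro allI impI conjI)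
  obtain m where m: "n = m + 5" using n le_Suc_ex[of 5 n] by (auto simp: add.commute)
  fix j assume j: "j < n"
  show "y (nxt n j) \<noteq> y j"
  proof (cases "j + 1 < n")
    case True then show ?thesis using step[of j] by (simp add: nxt_def)
  next
    case False
    then have "j = n - 1" using j by simp
    then show ?thesis using ends n by (simp add: nxt_def)
  qed
  have "j + 4 < n \<or> j = m + 1 \<or> j = m + 2 \<or> j = m + 3 \<or> j = m + 4" using j m by linarith
  then consider "j + 4 < n" | "j = m + 1" | "j = m + 2" | "j = m + 3" | "j = m + 4"
    by (elim disjE)
  then show "\<not> (y (nxt n (nxt n j)) = y j \<and> y (nxt n (nxt n (nxt n (nxt n j)))) = y j)"
  proof cases
    case 1
    then have "nxt n (nxt n j) = j + 2" "nxt n (nxt n (j + 2)) = j + 4" by (simp_all add: nxt_def)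
    then show ?thesis using inner[of j] by simp
  next
    case 2
    then have "nxt n (nxt n j) = n - 2" "nxt n (nxt n (n - 2)) = 0" using m by (simp_all add: nxt_if)
    then show ?thesis using ends by simp
  next
    case 3
    then have "nxt n (nxt n j) = n - 1" "j = n - 3" using m by (simp_all add: nxt_if)
    then show ?thesis using ends by simp
  next
    case 4
    then have "nxt n (nxt n j) = 0" "j = n - 2" using m by (simp_all add: nxt_if)
    then show ?thesis using ends by simp
  next
    case 5
    then have "nxt n (nxt n j) = 1" "j = n - 1" using m by (simp_all add: nxt_if)
    then show ?thesis using ends by simp
  qed
qed

text \<open>The word is a prefix of length \<open>N\<close>, ending with \<open>012\<close> if it has three letters or more, followed by
\<open>012012...\<close>. In the periodic part, letters at distance 1 or 2 differ, which excludes both forbidden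
patterns there; the prefix has to be checked by hand.\<close>

lemma rim_coloring_prefix:
  assumes n: "5 \<le> n" "n = 3 * m + N"
    and late: "\<And>i. y (N + i) = i mod 3"
    and early: "\<And>j. j < N \<Longrightarrow> y (j + 1) \<noteq> y j"
      "\<And>j. j < N \<Longrightarrow> \<not> (y (j + 2) = y j \<and> y (j + 4) = y j)"
    and start: "y 0 = 0" "y 1 = 1"
    and stop: "3 \<le> N \<Longrightarrow> y (N - 3) = 0" "3 \<le> N \<Longrightarrow> y (N - 2) = 1" "3 \<le> N \<Longrightarrow> y (N - 1) = 2"
  shows "rim_coloring n y"
proof (rule rim_coloringI[OF n(1)])
  have late_step: "y (j + 1) \<noteq> y j" "y (j + 2) \<noteq> y j" if Nj: "N \<le> j" for j
  proof -
    obtain i where i: "j = N + i" using le_Suc_ex[OF Nj] by blast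
    have "(i + 1) mod 3 \<noteq> i mod 3" "(i + 2) mod 3 \<noteq> i mod 3" by presburger+
    then show "y (j + 1) \<noteq> y j" "y (j + 2) \<noteq> y j"
      unfolding i add.assoc late by simp_all
  qed
  show "y (j + 1) \<noteq> y j" for j
    using early(1)[of j] late_step(1)[of j] by (meson not_less)
  show "\<not> (y (j + 2) = y j \<and> y (j + 4) = y j)" for j
    using early(2)[of j] late_step(2)[of j] by (meson not_less)
  show "y 0 = 0" "y 1 = 1" by fact+
  have "y (n - 3) = 0 \<and> y (n - 2) = 1 \<and> y (n - 1) = 2"
  proof (cases m)
    case 0
    with n stop show ?thesis by simp
  next
    case (Suc l)
    then have "n - 3 = N + 3 * l" "n - 2 = N + (3 * l + 1)" "n - 1 = N + (3 * l + 2)"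
      using n(2) by simp_all
    moreover have "3 * l mod 3 = 0" "(3 * l + 1) mod 3 = 1" "(3 * l + 2) mod 3 = 2" by presburger+
    ultimately show ?thesis using late by metis
  qed
  then show "y (n - 3) = 0" "y (n - 2) = 1" "y (n - 1) = 2" by simp_all
qed

text \<open>According to the residue of \<open>n\<close> modulo 3, the prefix consists of zero, one or two copies of \<open>01012\<close>.
Two copies require \<open>n \<ge> 10\<close>, which excludes only \<open>7\<close> in the range \<open>n \<ge> 5\<close>.\<close>

lemma rim_coloring_3_ex:
  assumes n: "5 \<le> n" "n \<noteq> 7"
  shows "\<exists>y. rim_coloring n y \<and> y ` {..<n} \<subseteq> {..<3}"
proof -
  have "n mod 3 = 0 \<or> n mod 3 = 2 \<or> n mod 3 = 1 \<and> 10 \<le> n" using n by presburger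
  then consider m where "n = 3 * m" | m where "n = 3 * m + 5" | m where "n = 3 * m + 10"
  proof (elim disjE conjE)
    assume "n mod 3 = 0"
    then have "n = 3 * (n div 3)" by presburger
    then show ?thesis by (rule that(1))
  next
    assume "n mod 3 = 2"
    then have "n = 3 * (n div 3 - 1) + 5" using n by presburger
    then show ?thesis by (rule that(2))
  next
    assume "n mod 3 = 1" "10 \<le> n"
    then have "n = 3 * (n div 3 - 3) + 10" by presburger
    then show ?thesis by (rule that(3))
  qed
  then show ?thesis
  proof cases
    case (1 m)
    define y where "y j = j mod 3" for j :: nat
    have "rim_coloring n y"
      using n 1 by (intro rim_coloring_prefix[of n m 0]) (simp_all add: y_def)
    then show ?thesis by (intro exI[of _ y]) (auto simp: y_def)
  next
    case (2 m)
    define y where "y j = (if j < 5 then [0, 1, 0, 1, 2] ! j else (j - 5) mod 3)" for j :: nat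
    have elems: "j = 0 \<or> j = 1 \<or> j = 2 \<or> j = 3 \<or> j = 4"
      if "j < 5" for j :: nat using that by presburger
    have "rim_coloring n y"
    proof (rule rim_coloring_prefix[OF n(1) 2])
      show "y (5 + i) = i mod 3" for i by (simp add: y_def)
      fix j :: nat assume "j < 5"
      from elems[OF this] show "y (j + 1) \<noteq> y j" "\<not> (y (j + 2) = y j \<and> y (j + 4) = y j)"
        by (elim disjE; simp add: y_def)+
    qed (simp_all add: y_def)
    moreover have "y j < 3" for j
    proof (cases "j < 5")
      case True
      from elems[OF this] show ?thesis by (elim disjE; simp add: y_def)
    qed (simp add: y_def)
    ultimately show ?thesis by (intro exI[of _ y]) auto
  next
    case (3 m)
    define y where "y j =
      (if j < 10 then [0, 1, 0, 1, 2, 0, 1, 0, 1, 2] ! j else (j - 10) mod 3)" for j :: nat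
    have elems: "j = 0 \<or> j = 1 \<or> j = 2 \<or> j = 3 \<or> j = 4 \<or> j = 5 \<or> j = 6 \<or> j = 7 \<or> j = 8 \<or> j = 9"
      if "j < 10" for j :: nat using that by presburger
    have "rim_coloring n y"
    proof (rule rim_coloring_prefix[OF n(1) 3])
      show "y (10 + i) = i mod 3" for i by (simp add: y_def)
      fix j :: nat assume "j < 10"
      from elems[OF this] show "y (j + 1) \<noteq> y j" "\<not> (y (j + 2) = y j \<and> y (j + 4) = y j)"
        by (elim disjE; simp add: y_def)+
    qed (simp_all add: y_def)
    moreover have "y j < 3" for j
    proof (cases "j < 10")
      case True
      from elems[OF this] show ?thesis by (elim disjE; simp add: y_def)
    qed (simp add: y_def)
    ultimately show ?thesis by (intro exI[of _ y]) auto
  qed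
qed

text \<open>The words \<open>0123\<close> and \<open>0120123\<close>.\<close>

lemma rim_coloring_4_ex:
  assumes "n = 4 \<or> n = 7"
  shows "\<exists>y. rim_coloring n y \<and> y ` {..<n} \<subseteq> {..<4}"
proof -
  let ?y = "\<lambda>j. if j = n - 1 then 3 else j mod 3 :: nat"
  have "rim_coloring n ?y"
    unfolding rim_coloring_def
  proof (intro allI impI)
    fix j assume "j < n"
    then have "j \<in> {0,1,2,3,4,5,6}" using assms by auto
    with assms \<open>j < n\<close> show "?y (nxt n j) \<noteq> ?y j \<and> \<not> (?y (nxt n (nxt n j)) = ?y j \<and>
        ?y (nxt n (nxt n (nxt n (nxt n j)))) = ?y j)"
      by (auto simp: nxt_def)
  qed
  then show ?thesis by (intro exI[of _ ?y]) auto
qed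

lemma ss_chromatic_index_double_wheel:
  assumes "4 \<le> n"
  shows "ss_chromatic_index (double_wheel n) = (if n = 4 \<or> n = 7 then 2 * n + 4 else 2 * n + 3)"
proof (cases "n = 4 \<or> n = 7")
  case True
  then obtain y where "rim_coloring n y" "y ` {..<n} \<subseteq> {..<4}" using rim_coloring_4_ex by blast
  then have "ss_chromatic_index (double_wheel n) = 2 * n + 4"
    using assms True rim_coloring_ge4_cycle4 rim_coloring_ge4_cycle7
    by (intro ss_chromatic_index_double_wheel_eqI) auto
  with True show ?thesis by simp
next
  case False
  then obtain y where "rim_coloring n y" "y ` {..<n} \<subseteq> {..<3}"
    using rim_coloring_3_ex[of n] assms by auto
  then have "ss_chromatic_index (double_wheel n) = 2 * n + 3"
    using assms False rim_coloring_ge3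
    by (intro ss_chromatic_index_double_wheel_eqI) auto
  with False show ?thesis by simp
qed

section \<open>The uniquely restricted chromatic index\<close>

text \<open>Disjoint spokes \<open>i t\<close> and \<open>k s\<close> lie on the alternating 4-cycle \<open>i t k s\<close>.\<close>

lemma ur_spokes_eq:
  assumes n: "3 \<le> n" and ur: "uniquely_restricted (double_wheel n) (dw_edge n ` S)"
    and S: "S \<subseteq> dw_index n" and a: "Inr (i, t) \<in> S" and b: "Inr (k, s) \<in> S"
  shows "i = k \<and> t = s"
proof (rule ccontr)
  assume ne: "\<not> (i = k \<and> t = s)"
  note eq = dw_disjoint_eq[OF n uniquely_restricted_disjoint[OF ur] S a b]
  have "i \<noteq> k" "t \<noteq> s" using ne eq[of "Inl i"] eq[of "Inr t"] by auto
  moreover have "i < n" "k < n" "t < 2" "s < 2" using S a b by (auto dest: subsetD)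
  moreover have "{Inl i, Inr t} \<in> dw_edge n ` S" "{Inr s, Inl k} \<in> dw_edge n ` S"
    using imageI[OF a, of "dw_edge n"] imageI[OF b, of "dw_edge n"] by (simp_all add: insert_commute)
  ultimately show False
    using not_uniquely_restricted_square[of "Inl i" "Inr t" "dw_edge n ` S" "Inr s" "Inl k" "double_wheel n"]
      ur spoke_in[OF n] by (simp add: doubleton_eq_iff insert_commute)
qed

lemma ur_single_edge:
  assumes n: "3 \<le> n" and e: "e \<in> edges (double_wheel n)"
  shows "uniquely_restricted (double_wheel n) {e}"
proof -
  have "{} \<notin> edges (double_wheel n)" using empty_not_edge[OF n] .
  moreover have "card e = 2" using card_edge[OF n e] .
  then obtain v where "v \<in> e" by fastforce
  moreover have "f = e" if "f \<in> edges (double_wheel n)" "f \<subseteq> e" for f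
    using card_edge[OF n] that e \<open>card e = 2\<close>
    by (intro card_subset_eq) (auto intro: card_ge_0_finite)
  ultimately show ?thesis
    using uniquely_restricted_insert[OF uniquely_restricted_empty, of "double_wheel n" e v] e by simp
qed

text \<open>The rim vertex \<open>i = j + 3\<close> is adjacent neither to \<open>j\<close> nor to \<open>j + 1\<close>, since \<open>n \<ge> 5\<close>. Its only covered
neighbor is the hub, so the spoke can be peeled off.\<close>

lemma ur_rim_spoke:
  assumes n: "5 \<le> n" and j: "j < n" and i: "i = nxt n (nxt n (nxt n j))"
  shows "uniquely_restricted (double_wheel n) {dw_edge n (Inr (i, 0)), dw_edge n (Inl j)}"
proof -
  have n3: "3 \<le> n" using n by simp
  have less: "nxt n j < n" "nxt n (nxt n j) < n" "i < n" using j i nxt_less by simp_all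
  have ne: "i \<noteq> j" "i \<noteq> nxt n j" "nxt n i \<noteq> j" "nxt n i \<noteq> nxt n j" "nxt n i \<noteq> i"
      "nxt n (nxt n j) \<noteq> j" "nxt n (nxt n j) \<noteq> nxt n j" "nxt n (nxt n j) \<noteq> i"
    using j n by (auto simp: i nxt_if split: if_splits)
  have rim: "dw_edge n (Inl j) \<in> edges (double_wheel n)" using rim_in[OF n3 j] by simp
  have "uniquely_restricted (double_wheel n) {dw_edge n (Inl j)}"
    using ur_single_edge[OF n3 rim] .
  then show ?thesis
  proof (rule uniquely_restricted_insert[where v = "Inl i"])
    show "dw_edge n (Inr (i, 0)) \<in> edges (double_wheel n)" using spoke_in[OF n3 less(3)] by simp
    show "disjnt (dw_edge n (Inr (i, 0))) f" if "f \<in> {dw_edge n (Inl j)}" for f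
      using that ne by simp
    fix f assume f: "f \<in> edges (double_wheel n)" "Inl i \<in> f"
      "f \<subseteq> \<Union>{dw_edge n (Inr (i, 0)), dw_edge n (Inl j)}"
    from f(1) show "f = dw_edge n (Inr (i, 0))"
    proof (rule edge_cases[OF n3])
      fix k assume k: "f = dw_edge n (Inl k)" "k < n"
      then have sub: "k \<in> {i, j, nxt n j}" "nxt n k \<in> {i, j, nxt n j}" using f(3) by auto
      show ?thesis
      proof (cases "k = i")
        case True with sub ne show ?thesis by simp
      next
        case False
        then have "nxt n k = nxt n (nxt n (nxt n j))" using f(2) k i by simp
        then have "k = nxt n (nxt n j)" using nxt_eq_iff k less by blast
        with sub ne show ?thesis by simp
      qed
    next
      fix k s assume "f = dw_edge n (Inr (k, s))"
      then show ?thesis using f(2,3) by auto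
    qed
  qed simp
qed

lemma ur_inj_on_spokes:
  assumes n: "3 \<le> n" and ur: "\<And>c. uniquely_restricted (double_wheel n) (dw_edge n ` {a \<in> dw_index n. x a = c})"
  shows "inj_on x (Inr ` ({..<n} \<times> {..<2}))"
proof (rule inj_onI)
  fix a b assume a: "a \<in> Inr ` ({..<n} \<times> {..<2})" and b: "b \<in> Inr ` ({..<n} \<times> {..<2})" and eq: "x a = x b"
  obtain i t where it: "a = Inr (i, t)" "i < n" "t < 2" using a by blast
  obtain k s where ks: "b = Inr (k, s)" "k < n" "s < 2" using b by blast
  have "i = k \<and> t = s"
    using eq it ks by (intro ur_spokes_eq[OF n ur[of "x a"]]) auto
  then show "a = b" using it ks by simp
qed

lemma ur_chromatic_index_ge5:
  assumes n: "5 \<le> n"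
  shows "ur_chromatic_index (double_wheel n) = 2 * n"
proof (rule ur_chromatic_index_eqI[OF bij_dw_edge])
  show n3: "3 \<le> n" using n by simp
  \<comment> \<open>The rim edge \<open>j\<close> shares the color of the spoke from \<open>j + 3\<close> to the hub 0.\<close>
  define opp where "opp j = nxt n (nxt n (nxt n j))" for j
  define x where "x = case_sum opp (\<lambda>(i, t). i + n * t)"
  have x_simps [simp]: "x (Inl j) = opp j" "x (Inr (i, t)) = i + n * t" for i j t
    by (simp_all add: x_def)
  have opp_less: "opp j < n" if "j < n" for j using that by (simp add: opp_def nxt_less)
  have opp_inj: "opp j = opp k \<longleftrightarrow> j = k" if "j < n" "k < n" for j k
    using that by (simp add: opp_def nxt_eq_iff nxt_less)
  fix c
  let ?S = "{a \<in> dw_index n. x a = c}"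
  show "uniquely_restricted (double_wheel n) (dw_edge n ` ?S)"
  proof (cases "\<exists>j<n. opp j = c")
    case True
    then obtain j where j: "j < n" "opp j = c" by blast
    have "?S = {Inr (opp j, 0), Inl j}"
    proof (intro equalityI subsetI)
      fix a assume a: "a \<in> ?S"
      then have "a \<in> dw_index n" by simp
      then show "a \<in> {Inr (opp j, 0), Inl j}"
      proof (cases rule: dw_index_cases)
        case (1 k)
        then show ?thesis using a j opp_inj[of k j] by simp
      next
        case (2 k s)
        then show ?thesis using a j opp_less[of j] spoke_color_eq_iff[of k n "opp j" s 0] by simp
      qed
    next
      fix a :: "nat + nat \<times> nat" assume "a \<in> {Inr (opp j, 0), Inl j}"
      then show "a \<in> ?S" using j opp_less[of j] by auto
    qed
    then show ?thesis using ur_rim_spoke[OF n j(1)] by (simp add: opp_def)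
  next
    case no_rim: False
    show ?thesis
    proof (cases "?S = {}")
      case True
      show ?thesis unfolding True using uniquely_restricted_empty empty_not_edge[OF n3] by simp
    next
      case False
      have spoke: "\<exists>i t. a = Inr (i, t) \<and> i < n \<and> t < 2 \<and> i + n * t = c" if a: "a \<in> ?S" for a
      proof -
        have "a \<in> dw_index n" using a by simp
        then show ?thesis using a no_rim by (cases rule: dw_index_cases) auto
      qed
      obtain a where a: "a \<in> ?S" using False by blast
      have "b = a" if b: "b \<in> ?S" for b
        using spoke[OF a] spoke[OF b] spoke_color_eq_iff by blast
      then have "?S = {a}" using a by blast
      then have "dw_edge n ` ?S = {dw_edge n a}" by simp
      then show ?thesis using ur_single_edge[OF n3 dw_edge_in[OF n3]] a by simp
    qed
  qed
  show "x ` dw_index n \<subseteq> {..<2 * n}"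
  proof
    fix c assume "c \<in> x ` dw_index n"
    then obtain a where a: "c = x a" "a \<in> dw_index n" ..
    from a(2) show "c \<in> {..<2 * n}"
    proof (cases rule: dw_index_cases)
      case (1 j)
      then show ?thesis using a opp_less[of j] by simp
    next
      case (2 i t)
      then show ?thesis using a spoke_color_less[of i n t] by simp
    qed
  qed
next
  fix x :: "nat + nat \<times> nat \<Rightarrow> nat" and l
  assume ur: "\<And>c. uniquely_restricted (double_wheel n) (dw_edge n ` {a \<in> dw_index n. x a = c})"
    and x: "x ` dw_index n \<subseteq> {..<l}"
  have "card (x ` Inr ` ({..<n} \<times> {..<2})) = 2 * n"
    using ur_inj_on_spokes[OF _ ur] n by (simp add: card_image card_cartesian_product)
  moreover have "x ` Inr ` ({..<n} \<times> {..<2}) \<subseteq> x ` dw_index n" by (intro image_mono) auto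
  then have "card (x ` Inr ` ({..<n} \<times> {..<2})) \<le> card {..<l}"
    using x by (intro card_mono) simp_all
  ultimately show "2 * n \<le> l" by simp
qed

text \<open>On the 4-cycle every vertex off a rim edge is adjacent to one end of it, while the hub is adjacent
to the other end: an alternating 4-cycle.\<close>

lemma ur4_rim_spoke:
  assumes ur: "uniquely_restricted (double_wheel 4) (dw_edge 4 ` S)"
    and S: "S \<subseteq> dw_index 4" and a: "Inl j \<in> S" and b: "Inr (i, t) \<in> S"
  shows False
proof -
  have n3: "3 \<le> (4::nat)" by simp
  have less: "j < 4" "i < 4" "t < 2" "nxt 4 j < 4" using S a b by (auto dest: subsetD simp: nxt_def)
  note eq = dw_disjoint_eq[OF n3 uniquely_restricted_disjoint[OF ur] S a b, of "Inl i"]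
  then have "i \<noteq> j" "i \<noteq> nxt 4 j" by auto
  then have i: "i = nxt 4 (nxt 4 j) \<or> nxt 4 i = j"
    using less by (auto simp: nxt_if split: if_splits)
  have M: "{Inl i, Inr t} \<in> dw_edge 4 ` S" "{Inl j, Inl (nxt 4 j)} \<in> dw_edge 4 ` S"
    "{Inl (nxt 4 j), Inl j} \<in> dw_edge 4 ` S"
    using imageI[OF a, of "dw_edge 4"] imageI[OF b, of "dw_edge 4"] by (simp_all add: insert_commute)
  have spokes: "{Inr t, Inl k} \<in> edges (double_wheel 4)" if "k < 4" for k
    using spoke_in[OF n3 that less(3)] by (simp add: insert_commute)
  have ne: "j \<noteq> nxt 4 j" "nxt 4 j \<noteq> j" using nxt_neq[of 4 j] less by auto
  from i show False
  proof
    assume i: "i = nxt 4 (nxt 4 j)"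
    have "{Inl i, Inl (nxt 4 j)} \<in> edges (double_wheel 4)"
      using rim_in[OF n3 less(4)] by (simp add: i insert_commute)
    from not_uniquely_restricted_square[OF M(1,3) _ this spokes[OF less(1)]]
    show False using ur ne by (simp add: doubleton_eq_iff)
  next
    assume i: "nxt 4 i = j"
    have "{Inl i, Inl j} \<in> edges (double_wheel 4)"
      using rim_in[OF n3 less(2)] by (simp add: i)
    from not_uniquely_restricted_square[OF M(1,2) _ this spokes[OF less(4)]]
    show False using ur ne by (simp add: doubleton_eq_iff)
  qed
qed

text \<open>Disjoint rim edges of the 4-cycle are opposite, and the rim itself is an alternating 4-cycle.\<close>

lemma ur4_rim_eq:
  assumes ur: "uniquely_restricted (double_wheel 4) (dw_edge 4 ` S)"
    and S: "S \<subseteq> dw_index 4" and a: "Inl j \<in> S" and b: "Inl k \<in> S"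
  shows "j = k"
proof (rule ccontr)
  assume "j \<noteq> k"
  have n3: "3 \<le> (4::nat)" by simp
  have less: "j < 4" "k < 4" "nxt 4 j < 4" "nxt 4 k < 4"
    using S a b by (auto dest: subsetD simp: nxt_def)
  note eq = dw_disjoint_eq[OF n3 uniquely_restricted_disjoint[OF ur] S a b]
  have "k \<noteq> nxt 4 j" "j \<noteq> nxt 4 k"
    using \<open>j \<noteq> k\<close> eq[of "Inl k"] eq[of "Inl j"] by auto
  then have jk: "k = nxt 4 (nxt 4 j)" "j = nxt 4 (nxt 4 k)"
    using \<open>j \<noteq> k\<close> less by (auto simp: nxt_if split: if_splits)
  have M: "{Inl j, Inl (nxt 4 j)} \<in> dw_edge 4 ` S" "{Inl (nxt 4 k), Inl k} \<in> dw_edge 4 ` S"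
    using imageI[OF a, of "dw_edge 4"] imageI[OF b, of "dw_edge 4"] by (simp_all add: insert_commute)
  have ne: "j \<noteq> nxt 4 j" "nxt 4 k \<noteq> k" using nxt_neq[of 4 j] nxt_neq[of 4 k] less by auto
  have "{Inl j, Inl (nxt 4 k)} \<in> edges (double_wheel 4)"
    using rim_in[OF n3 less(4)] jk(2)[symmetric] by (simp add: insert_commute)
  moreover have "{Inl (nxt 4 j), Inl k} \<in> edges (double_wheel 4)"
    using rim_in[OF n3 less(3)] jk(1)[symmetric] by simp
  ultimately show False
    using not_uniquely_restricted_square[OF M] ur \<open>j \<noteq> k\<close> \<open>k \<noteq> nxt 4 j\<close> ne
    by (auto simp: doubleton_eq_iff)
qed

lemma ur_chromatic_index_4: "ur_chromatic_index (double_wheel 4) = 12"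
proof (rule ur_chromatic_index_eqI[OF bij_dw_edge])
  show n3: "3 \<le> (4::nat)" by simp
  define x where "x = case_sum (\<lambda>j. 8 + j) (\<lambda>(i, t). i + 4 * t :: nat)"
  have less: "i + 4 * t < 8" if "i < 4" "t < 2" for i t :: nat
    using spoke_color_less[OF that] by simp
  have inj: "a = b" if ab: "a \<in> dw_index 4" "b \<in> dw_index 4" "x a = x b" for a b
    using ab(1)
  proof (cases rule: dw_index_cases)
    case a: (1 j)
    from ab(2) show ?thesis
      by (cases rule: dw_index_cases) (use ab(3) a less in \<open>fastforce simp: x_def\<close>)+
  next
    case a: (2 i t)
    from ab(2) show ?thesis
    proof (cases rule: dw_index_cases)
      case (1 k)
      then show ?thesis using ab(3) a less[of i t] by (simp add: x_def)
    next
      case (2 k s)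
      then show ?thesis using ab(3) a spoke_color_eq_iff[of i 4 k t s] by (simp add: x_def)
    qed
  qed
  show "uniquely_restricted (double_wheel 4) (dw_edge 4 ` {a \<in> dw_index 4. x a = c})" for c
  proof (cases "{a \<in> dw_index 4. x a = c} = {}")
    case True
    show ?thesis unfolding True using uniquely_restricted_empty empty_not_edge[OF n3] by simp
  next
    case False
    then obtain a where a: "a \<in> dw_index 4" "x a = c" by blast
    then have "{a \<in> dw_index 4. x a = c} = {a}" using inj by blast
    then have "dw_edge 4 ` {a \<in> dw_index 4. x a = c} = {dw_edge 4 a}" by simp
    then show ?thesis using ur_single_edge[OF n3 dw_edge_in[OF n3 a(1)]] by simp
  qed
  show "x ` dw_index 4 \<subseteq> {..<12}"
  proof
    fix c assume "c \<in> x ` dw_index 4"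
    then obtain a where a: "c = x a" "a \<in> dw_index 4" ..
    from a(2) show "c \<in> {..<12}"
    proof (cases rule: dw_index_cases)
      case (1 j)
      then show ?thesis using a by (simp add: x_def)
    next
      case (2 i t)
      then show ?thesis using a less[of i t] by (simp add: x_def)
    qed
  qed
next
  fix x :: "nat + nat \<times> nat \<Rightarrow> nat" and l
  assume ur: "\<And>c. uniquely_restricted (double_wheel 4) (dw_edge 4 ` {a \<in> dw_index 4. x a = c})"
    and x: "x ` dw_index 4 \<subseteq> {..<l}"
  have "inj_on x (dw_index 4)"
  proof (rule inj_onI)
    fix a b assume ab: "a \<in> dw_index 4" "b \<in> dw_index 4" "x a = x b"
    let ?S = "{d \<in> dw_index 4. x d = x a}"
    have S: "?S \<subseteq> dw_index 4" "a \<in> ?S" "b \<in> ?S" using ab by auto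
    from ab(1) show "a = b"
    proof (cases rule: dw_index_cases)
      case a: (1 j)
      from ab(2) show ?thesis
      proof (cases rule: dw_index_cases)
        case (1 k)
        then show ?thesis using ur4_rim_eq[OF ur S(1), of j k] S a by simp
      next
        case (2 i t)
        then show ?thesis using ur4_rim_spoke[OF ur S(1), of j i t] S a by simp
      qed
    next
      case a: (2 i t)
      from ab(2) show ?thesis
      proof (cases rule: dw_index_cases)
        case (1 k)
        then show ?thesis using ur4_rim_spoke[OF ur S(1), of k i t] S a by simp
      next
        case (2 k s)
        then show ?thesis using ur_spokes_eq[OF _ ur S(1), of i t k s] S a by simp
      qed
    qed
  qed
  then have "card (x ` dw_index 4) = 12"
    by (simp add: card_image dw_index_def card_Plus card_cartesian_product)
  moreover have "card (x ` dw_index 4) \<le> card {..<l}"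
    using x by (intro card_mono) simp_all
  ultimately show "12 \<le> l" by simp
qed

lemma ur_chromatic_index_double_wheel:
  assumes "4 \<le> n"
  shows "ur_chromatic_index (double_wheel n) = (if n = 4 then 2 * n + 4 else 2 * n)"
  using ur_chromatic_index_4 ur_chromatic_index_ge5[of n] assms by auto

section \<open>Straight-line drawings\<close>

text \<open>Twice the signed area of the triangle \<open>a b c\<close>; as a function of \<open>c\<close> it is affine and vanishes on the
line through \<open>a\<close> and \<open>b\<close>.\<close>

definition orient :: "complex \<Rightarrow> complex \<Rightarrow> complex \<Rightarrow> real" where
  "orient a b c = (Re b - Re a) * (Im c - Im a) - (Im b - Im a) * (Re c - Re a)"

lemma orient_convex_comb:
  "orient c d ((1 - t) *\<^sub>R a + t *\<^sub>R b) = (1 - t) * orient c d a + t * orient c d b"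
  by (simp add: orient_def algebra_simps)

lemma orient_on_line:
  assumes "z \<in> closed_segment a b"
  shows "orient a b z = 0"
proof -
  obtain t where z: "z = (1 - t) *\<^sub>R a + t *\<^sub>R b" using assms by (auto simp: in_segment)
  have "orient a b a = 0" "orient a b b = 0" by (simp_all add: orient_def)
  then show ?thesis unfolding z orient_convex_comb by simp
qed

text \<open>If \<open>a\<close> lies strictly on one side of the line through \<open>c\<close> and \<open>d\<close>, and \<open>b\<close> is on the same side or on
the line, then only the end \<open>b\<close> of the segment can lie on that line.\<close>

lemma segments_meet_at_end:
  assumes z: "z \<in> closed_segment a b" "z \<in> closed_segment c d"
    and side: "0 \<le> orient c d a * orient c d b" "orient c d a \<noteq> 0"
  shows "z = b \<and> orient c d b = 0"
proof -
  obtain t where t: "z = (1 - t) *\<^sub>R a + t *\<^sub>R b" "0 \<le> t" "t \<le> 1"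
    using z(1) by (auto simp: in_segment)
  have "(1 - t) * orient c d a + t * orient c d b = 0"
    using orient_on_line[OF z(2)] unfolding t orient_convex_comb .
  \<comment> \<open>Multiplying by the value at \<open>a\<close> makes both summands non-negative.\<close>
  then have "orient c d a * ((1 - t) * orient c d a + t * orient c d b) = 0" by simp
  then have "(1 - t) * (orient c d a)\<^sup>2 + t * (orient c d a * orient c d b) = 0"
    by (simp add: algebra_simps power2_eq_square)
  moreover have "0 \<le> (1 - t) * (orient c d a)\<^sup>2" "0 \<le> t * (orient c d a * orient c d b)"
    using t side by simp_all
  ultimately have "(1 - t) * (orient c d a)\<^sup>2 = 0" by linarith
  then have "t = 1" using side by simp
  then have "z = b" using t(1) by simp
  then show ?thesis using orient_on_line[OF z(2)] by simp
qed

lemma planarI_straight: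
  fixes p :: "'a \<Rightarrow> complex"
  assumes E: "edges G = (\<lambda>(u, v). {u, v}) ` E"
    and verts: "\<And>u v. (u, v) \<in> E \<Longrightarrow> u \<in> verts G \<and> v \<in> verts G \<and> u \<noteq> v"
    and inj: "inj_on p (verts G)"
    and avoid: "\<And>u v w. (u, v) \<in> E \<Longrightarrow> w \<in> verts G \<Longrightarrow> p w \<in> closed_segment (p u) (p v) \<Longrightarrow> w \<in> {u, v}"
    and meet: "\<And>u v x y. (u, v) \<in> E \<Longrightarrow> (x, y) \<in> E \<Longrightarrow> {u, v} \<noteq> {x, y} \<Longrightarrow>
      closed_segment (p u) (p v) \<inter> closed_segment (p x) (p y) \<subseteq> p ` ({u, v} \<inter> {x, y})"
  shows "planar G"
proof -
  \<comment> \<open>An edge is a set; an ordered pair of ends is chosen to give its arc a direction.\<close>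
  define ends where "ends e = (SOME q. q \<in> E \<and> e = {fst q, snd q})" for e
  have ends: "ends e \<in> E \<and> e = {fst (ends e), snd (ends e)}" if "e \<in> edges G" for e
    unfolding ends_def by (rule someI_ex) (use that E in auto)
  define \<gamma> where "\<gamma> e = linepath (p (fst (ends e))) (p (snd (ends e)))" for e
  have edge: "\<exists>u v. (u, v) \<in> E \<and> e = {u, v} \<and> \<gamma> e = linepath (p u) (p v)" if "e \<in> edges G" for e
    using ends[OF that] unfolding \<gamma>_def by (metis prod.collapse)
  show ?thesis
    unfolding planar_def
  proof (intro exI[of _ p] exI[of _ \<gamma>] conjI ballI impI)
    show "inj_on p (verts G)" by (rule inj)
  next
    fix e assume "e \<in> edges G"
    then obtain u v where e: "(u, v) \<in> E" "e = {u, v}" "\<gamma> e = linepath (p u) (p v)" using edge by blast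
    have "p u \<noteq> p v" using verts[OF e(1)] inj by (auto dest: inj_onD)
    then show "arc (\<gamma> e)" unfolding e(3) by simp
    show "{pathstart (\<gamma> e), pathfinish (\<gamma> e)} = p ` e" unfolding e(3) by (simp add: e(2))
    show "path_image (\<gamma> e) \<inter> p ` verts G = p ` e"
    proof (intro equalityI subsetI)
      fix z assume "z \<in> path_image (\<gamma> e) \<inter> p ` verts G"
      then obtain w where "z = p w" "w \<in> verts G" "p w \<in> closed_segment (p u) (p v)"
        by (auto simp: e(3))
      then show "z \<in> p ` e" using avoid[OF e(1)] e(2) by blast
    next
      fix z assume "z \<in> p ` e"
      then show "z \<in> path_image (\<gamma> e) \<inter> p ` verts G"
        unfolding e(3) using verts[OF e(1)] by (auto simp: e(2))
    qed
  next
    fix e f assume "e \<in> edges G" "f \<in> edges G" and ne: "e \<noteq> f"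
    then obtain u v x y where "(u, v) \<in> E" "e = {u, v}" "\<gamma> e = linepath (p u) (p v)"
        "(x, y) \<in> E" "f = {x, y}" "\<gamma> f = linepath (p x) (p y)"
      using edge by meson
    then show "path_image (\<gamma> e) \<inter> path_image (\<gamma> f) \<subseteq> p ` (e \<inter> f)"
      using meet[of u v x y] ne by simp
  qed
qed

section \<open>Planar graphs of maximum degree seven\<close>

definition wheel7_vertex :: "nat + nat \<Rightarrow> nat" where
  "wheel7_vertex = case_sum id (\<lambda>t. 7 + t)"

text \<open>The double wheel over the 7-cycle on the vertices \<open>0, ..., 8\<close>, the hubs being \<open>7\<close> and \<open>8\<close>, together
with \<open>m\<close> isolated vertices.\<close>

definition padded_wheel7 :: "nat \<Rightarrow> nat graph" where
  "padded_wheel7 m =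
     \<lparr>verts = {..<9 + m}, edges = (`) wheel7_vertex ` edges (double_wheel 7)\<rparr>"

definition wheel7_ends :: "(nat \<times> nat) list" where
  "wheel7_ends =
     [(0, 1), (1, 2), (2, 3), (3, 4), (4, 5), (5, 6), (6, 0),
      (0, 7), (0, 8), (1, 7), (1, 8), (2, 7), (2, 8), (3, 7), (3, 8),
      (4, 7), (4, 8), (5, 7), (5, 8), (6, 7), (6, 8)]"

lemma edges_padded_wheel7:
  "edges (padded_wheel7 m) = (\<lambda>(u, v). {u, v}) ` set wheel7_ends"
proof -
  define ends where "ends = case_sum (\<lambda>j. (j, nxt 7 j)) (\<lambda>(i, t). (i, 7 + t))"
  have "wheel7_vertex ` dw_edge 7 a = (\<lambda>(u, v). {u, v}) (ends a)" for a
    by (cases "(7::nat, a)" rule: dw_edge.cases) (auto simp: ends_def wheel7_vertex_def)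
  moreover have "edges (double_wheel 7) = dw_edge 7 ` dw_index 7"
    using bij_dw_edge[of 7] by (simp add: bij_betw_def)
  ultimately have "edges (padded_wheel7 m) = (\<lambda>(u, v). {u, v}) ` ends ` dw_index 7"
    by (simp add: padded_wheel7_def image_image)
  also have "dw_index 7 = set (map Inl [0..<7] @ map Inr (List.product [0..<7] [0..<2]))"
    by (auto simp: dw_index_def)
  also have "ends ` \<dots> = set (map ends (map Inl [0..<7] @ map Inr (List.product [0..<7] [0..<2])))"
    by (simp only: set_map)
  also have "map ends (map Inl [0..<7] @ map Inr (List.product [0..<7] [0..<2])) = wheel7_ends"
    by (simp add: ends_def wheel7_ends_def nxt_def upt_rec)
  finally show ?thesis .
qed

text \<open>The rim vertices lie on the parabola \<open>y = x (6 - x)\<close>, so they form a convex polygon. The hub 8 lies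
inside it, and the hub 7 far above it, where it sees all the rim vertices; the outer face is the
triangle \<open>0 6 7\<close>. The hubs are placed so that no third vertex of the wheel is on the line through two
adjacent ones. The isolated vertices are put on the x-axis to the right of everything else.\<close>

definition wheel7_coord :: "nat \<Rightarrow> int \<times> int" where
  "wheel7_coord w =
     (if w < 9 then [(0, 0), (1, 5), (2, 8), (3, 9), (4, 8), (5, 5), (6, 0), (1, 26), (2, 1)] ! w
      else (int w, 0))"

definition wheel7_point :: "nat \<Rightarrow> complex" where
  "wheel7_point w = Complex (of_int (fst (wheel7_coord w))) (of_int (snd (wheel7_coord w)))"

definition wheel7_orient :: "nat \<Rightarrow> nat \<Rightarrow> nat \<Rightarrow> int" where
  "wheel7_orient u v w =
     (fst (wheel7_coord v) - fst (wheel7_coord u)) * (snd (wheel7_coord w) - snd (wheel7_coord u)) -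
     (snd (wheel7_coord v) - snd (wheel7_coord u)) * (fst (wheel7_coord w) - fst (wheel7_coord u))"

lemma orient_wheel7_point:
  "orient (wheel7_point u) (wheel7_point v) (wheel7_point w) = of_int (wheel7_orient u v w)"
  by (simp add: orient_def wheel7_point_def wheel7_orient_def)

text \<open>The segment \<open>a b\<close> lies on one side of the line through \<open>c\<close> and \<open>d\<close>, touching it at most in one end,
which must be a common end of the two edges. Only integer arithmetic is involved, so that the
predicate can be decided by computation.\<close>

definition beside :: "nat \<times> nat \<Rightarrow> nat \<times> nat \<Rightarrow> bool" where
  "beside = (\<lambda>(a, b) (c, d). let x = wheel7_orient c d a; y = wheel7_orient c d b in
     0 \<le> x * y \<and> (x \<noteq> 0 \<or> y \<noteq> 0) \<and> (x = 0 \<longrightarrow> a \<in> {c, d}) \<and> (y = 0 \<longrightarrow> b \<in> {c, d}))"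

lemma beside_meet:
  assumes "beside (a, b) (c, d)"
    and z: "z \<in> closed_segment (wheel7_point a) (wheel7_point b)"
      "z \<in> closed_segment (wheel7_point c) (wheel7_point d)"
  shows "z \<in> wheel7_point ` ({a, b} \<inter> {c, d})"
proof -
  define x y where xy: "x = wheel7_orient c d a" "y = wheel7_orient c d b"
  have b: "0 \<le> x * y" "x \<noteq> 0 \<or> y \<noteq> 0" "x = 0 \<Longrightarrow> a \<in> {c, d}" "y = 0 \<Longrightarrow> b \<in> {c, d}"
    using assms(1) by (auto simp: beside_def xy Let_def)
  have nonneg: "0 \<le> orient (wheel7_point c) (wheel7_point d) (wheel7_point a) *
      orient (wheel7_point c) (wheel7_point d) (wheel7_point b)"
  proof -
    have "0 \<le> real_of_int (x * y)" using b(1) by (simp only: of_int_0_le_iff)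
    then show ?thesis unfolding orient_wheel7_point xy of_int_mult .
  qed
  show ?thesis
  proof (cases "x = 0")
    case False
    then have "z = wheel7_point b \<and> y = 0"
      using segments_meet_at_end[OF z nonneg] by (simp add: orient_wheel7_point xy)
    then show ?thesis using b(4) by blast
  next
    case True
    then have "z = wheel7_point a \<and> x = 0"
      using segments_meet_at_end[of z "wheel7_point b" "wheel7_point a"] z nonneg b(2)
      by (simp add: orient_wheel7_point xy closed_segment_commute mult.commute)
    then show ?thesis using b(3) by blast
  qed
qed

text \<open>Segments that do not cross can be separated by the line through one of them, but it may be either of
the two; hence the disjunction.\<close>

lemma wheel7_ends_beside:
  "\<forall>e\<in>set wheel7_ends. \<forall>f\<in>set wheel7_ends. e \<noteq> f \<longrightarrow> beside e f \<or> beside f e"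
  by code_simp

lemma wheel7_ends_avoid:
  "\<forall>(u, v)\<in>set wheel7_ends. u < 9 \<and> v < 9 \<and> u \<noteq> v \<and>
     (\<forall>w\<in>set [0..<9]. w \<noteq> u \<longrightarrow> w \<noteq> v \<longrightarrow> wheel7_orient u v w \<noteq> 0)"
  by code_simp

lemma planar_padded_wheel7: "planar (padded_wheel7 m)"
proof (rule planarI_straight[OF edges_padded_wheel7, where p = wheel7_point])
  have x_bound: "fst (wheel7_coord w) \<le> 6" if "w < 9" for w
  proof -
    have "\<forall>w\<in>set [0..<9]. fst (wheel7_coord w) \<le> 6" by code_simp
    then show ?thesis using that by simp
  qed
  have distinct: "wheel7_coord v \<noteq> wheel7_coord w" if "v < 9" "w < 9" "v \<noteq> w" for v w
  proof -
    have "\<forall>v\<in>set [0..<9]. \<forall>w\<in>set [0..<9]. v \<noteq> w \<longrightarrow> wheel7_coord v \<noteq> wheel7_coord w" by code_simp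
    then show ?thesis using that by simp
  qed
  have far: "wheel7_coord w = (int w, 0)" if "\<not> w < 9" for w using that by (simp add: wheel7_coord_def)
  show "inj_on wheel7_point (verts (padded_wheel7 m))"
  proof (rule inj_onI, rule ccontr)
    fix v w assume "wheel7_point v = wheel7_point w" and ne: "v \<noteq> w"
    then have eq: "wheel7_coord v = wheel7_coord w" by (simp add: wheel7_point_def prod_eq_iff)
    consider "v < 9" "w < 9" | "\<not> v < 9" "\<not> w < 9" | "v < 9" "\<not> w < 9" | "\<not> v < 9" "w < 9" by linarith
    then show False
    proof cases
      case 1 then show ?thesis using distinct eq ne by blast
    next
      case 2 then show ?thesis using far[of v] far[of w] eq ne by simp
    next
      case 3 then show ?thesis using x_bound[of v] far[of w] eq by simp
    next
      case 4 then show ?thesis using x_bound[of w] far[of v] eq by simp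
    qed
  qed
  fix u v assume uv: "(u, v) \<in> set wheel7_ends"
  have small: "u < 9" "v < 9" "u \<noteq> v" and off: "w < 9 \<Longrightarrow> w \<noteq> u \<Longrightarrow> w \<noteq> v \<Longrightarrow> wheel7_orient u v w \<noteq> 0" for w
    using bspec[OF wheel7_ends_avoid uv] by auto
  show "u \<in> verts (padded_wheel7 m) \<and> v \<in> verts (padded_wheel7 m) \<and> u \<noteq> v"
    using small by (simp add: padded_wheel7_def)
  show "w \<in> {u, v}" if w: "wheel7_point w \<in> closed_segment (wheel7_point u) (wheel7_point v)" for w
  proof (rule ccontr)
    assume out: "w \<notin> {u, v}"
    show False
    proof (cases "w < 9")
      case True
      then show False using off[of w] out orient_on_line[OF w] by (simp add: orient_wheel7_point)
    next
      case False
      have "closed_segment (wheel7_point u) (wheel7_point v) \<subseteq> {z. Re z \<le> 6}"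
        using x_bound small by (intro closed_segment_subset convex_halfspace_Re_le) (simp_all add: wheel7_point_def)
      then have "Re (wheel7_point w) \<le> 6" using w by blast
      then show False using False far[OF False] by (simp add: wheel7_point_def)
    qed
  qed
  fix x y assume xy: "(x, y) \<in> set wheel7_ends" and ne: "{u, v} \<noteq> {x, y}"
  show "closed_segment (wheel7_point u) (wheel7_point v) \<inter> closed_segment (wheel7_point x) (wheel7_point y)
      \<subseteq> wheel7_point ` ({u, v} \<inter> {x, y})"
  proof
    fix z assume z: "z \<in> closed_segment (wheel7_point u) (wheel7_point v) \<inter>
      closed_segment (wheel7_point x) (wheel7_point y)"
    have "(u, v) \<noteq> (x, y)" using ne by auto
    then have "beside (u, v) (x, y) \<or> beside (x, y) (u, v)" using wheel7_ends_beside uv xy by blast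
    then show "z \<in> wheel7_point ` ({u, v} \<inter> {x, y})"
      using beside_meet[of u v x y z] beside_meet[of x y u v z] z by (auto simp: Int_commute)
  qed
qed

lemma simple_padded_wheel7: "simple_graph (padded_wheel7 m)"
  unfolding simple_graph_def
proof (intro conjI ballI)
  show "finite (verts (padded_wheel7 m))" by (simp add: padded_wheel7_def)
  fix e assume "e \<in> edges (padded_wheel7 m)"
  then obtain u v where uv: "(u, v) \<in> set wheel7_ends" "e = {u, v}"
    unfolding edges_padded_wheel7 by auto
  have "u < 9" "v < 9" "u \<noteq> v" using bspec[OF wheel7_ends_avoid uv(1)] by auto
  then show "e \<subseteq> verts (padded_wheel7 m)" "card e = 2" by (simp_all add: uv(2) padded_wheel7_def)
qed

text \<open>No edge is listed twice, not even with its ends reversed, so degrees can be counted in the list.\<close>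

lemma degree_padded_wheel7:
  "degree (padded_wheel7 m) w = length (filter (\<lambda>(u, v). w = u \<or> w = v) wheel7_ends)"
proof -
  have no_rev: "\<forall>(u, v)\<in>set wheel7_ends. (v, u) \<notin> set wheel7_ends" by code_simp
  have inj: "inj_on (\<lambda>(u, v). {u, v}) (set wheel7_ends)"
  proof (rule inj_onI)
    fix q r assume qr: "q \<in> set wheel7_ends" "r \<in> set wheel7_ends"
      and eq: "(\<lambda>(u, v). {u, v}) q = (\<lambda>(u, v). {u, v}) r"
    obtain u v x y where uv: "q = (u, v)" "r = (x, y)" by (cases q; cases r)
    then have "u = x \<and> v = y \<or> u = y \<and> v = x" using eq by (simp add: doubleton_eq_iff)
    moreover have "(v, u) \<notin> set wheel7_ends" using bspec[OF no_rev qr(1)] uv by simp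
    ultimately show "q = r" using uv qr(2) by metis
  qed
  have "{e \<in> edges (padded_wheel7 m). w \<in> e} =
      (\<lambda>(u, v). {u, v}) ` set (filter (\<lambda>(u, v). w = u \<or> w = v) wheel7_ends)"
    unfolding edges_padded_wheel7 by auto
  then have "degree (padded_wheel7 m) w = card (set (filter (\<lambda>(u, v). w = u \<or> w = v) wheel7_ends))"
    unfolding degree_def by (simp add: card_image inj_on_subset[OF inj])
  moreover have "distinct wheel7_ends" by code_simp
  ultimately show ?thesis by (simp add: distinct_card del: set_filter)
qed

lemma max_degree_padded_wheel7: "max_degree (padded_wheel7 m) = 7"
  unfolding max_degree_def
proof (rule Max_eqI)
  show "finite (degree (padded_wheel7 m) ` verts (padded_wheel7 m))" by (simp add: padded_wheel7_def)
  have "length (filter (\<lambda>(u, v). 7 = u \<or> 7 = v) wheel7_ends) = 7" by code_simp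
  then have "degree (padded_wheel7 m) 7 = 7" unfolding degree_padded_wheel7 .
  moreover have "7 \<in> verts (padded_wheel7 m)" by (simp add: padded_wheel7_def)
  ultimately show "7 \<in> degree (padded_wheel7 m) ` verts (padded_wheel7 m)" by (metis imageI)
  fix k assume "k \<in> degree (padded_wheel7 m) ` verts (padded_wheel7 m)"
  then obtain w where k: "k = length (filter (\<lambda>(u, v). w = u \<or> w = v) wheel7_ends)"
    unfolding degree_padded_wheel7 by blast
  show "k \<le> 7"
  proof (cases "w < 9")
    case True
    have "\<forall>w\<in>set [0..<9]. length (filter (\<lambda>(u, v). w = u \<or> w = v) wheel7_ends) \<le> 7" by code_simp
    then show ?thesis using True k by simp
  next
    case False
    have "\<not> (case q of (u, v) \<Rightarrow> w = u \<or> w = v)" if "q \<in> set wheel7_ends" for q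
      using bspec[OF wheel7_ends_avoid that] False by auto
    then show ?thesis unfolding k by (simp add: filter_False)
  qed
qed

lemma ss_chromatic_index_padded_wheel7: "ss_chromatic_index (padded_wheel7 m) = 18"
proof -
  have "ss_chromatic_index (padded_wheel7 m) = ss_chromatic_index (double_wheel 7)"
  proof (rule ss_chromatic_index_image)
    show "edges (padded_wheel7 m) = (`) wheel7_vertex ` edges (double_wheel 7)"
      by (simp add: padded_wheel7_def)
    have "\<Union>(edges (double_wheel 7)) \<subseteq> Inl ` {..<7} \<union> range Inr"
    proof
      fix v assume "v \<in> \<Union>(edges (double_wheel 7))"
      then obtain e where e: "e \<in> edges (double_wheel 7)" "v \<in> e" by blast
      have "3 \<le> (7::nat)" by simp
      from this e(1) show "v \<in> Inl ` {..<7} \<union> range Inr"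
      proof (rule edge_cases)
        fix j assume "e = dw_edge 7 (Inl j)" "j < 7"
        then show ?thesis using e(2) nxt_less[of j 7] by auto
      next
        fix i t assume "e = dw_edge 7 (Inr (i, t))" "i < 7"
        then show ?thesis using e(2) by auto
      qed
    qed
    moreover have "inj_on wheel7_vertex (Inl ` {..<7} \<union> range Inr)"
      by (auto simp: inj_on_def wheel7_vertex_def)
    ultimately show "inj_on wheel7_vertex (\<Union>(edges (double_wheel 7)))"
      by (rule inj_on_subset[rotated])
  qed
  then show ?thesis by (simp add: ss_chromatic_index_double_wheel)
qed

lemma isomorphic_padded_wheel7:
  assumes "isomorphic (padded_wheel7 m) (padded_wheel7 k)"
  shows "m = k"
  using assms by (auto simp: isomorphic_def padded_wheel7_def dest: bij_betw_same_card)

theorem proposition3p1: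
  shows "(\<forall>\<Delta>::nat. \<Delta> \<ge> 4 \<longrightarrow>
           ur_chromatic_index (graph_join (cycle_graph \<Delta>) (independent_graph 2)) =
             (if \<Delta> = 4 then 2 * \<Delta> + 4 else 2 * \<Delta>) \<and>
           ss_chromatic_index (graph_join (cycle_graph \<Delta>) (independent_graph 2)) =
             (if \<Delta> = 4 \<or> \<Delta> = 7 then 2 * \<Delta> + 4 else 2 * \<Delta> + 3)) \<and>
         (\<exists>\<G> :: nat graph set. infinite \<G> \<and>
           (\<forall>G\<in>\<G>. simple_graph G \<and> planar G \<and> max_degree G = 7 \<and> ss_chromatic_index G \<ge> 18) \<and>
           (\<forall>G\<in>\<G>. \<forall>H\<in>\<G>. G \<noteq> H \<longrightarrow> \<not> isomorphic G H))"
proof (intro conjI exI[of _ "range padded_wheel7"])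
  have "inj padded_wheel7"
    by (rule injI) (auto simp: padded_wheel7_def)
  then show "infinite (range padded_wheel7)" by (rule range_inj_infinite)
  show "\<forall>G\<in>range padded_wheel7. simple_graph G \<and> planar G \<and> max_degree G = 7 \<and> ss_chromatic_index G \<ge> 18"
    by (simp add: simple_padded_wheel7 planar_padded_wheel7 max_degree_padded_wheel7
        ss_chromatic_index_padded_wheel7)
  show "\<forall>G\<in>range padded_wheel7. \<forall>H\<in>range padded_wheel7. G \<noteq> H \<longrightarrow> \<not> isomorphic G H"
    using isomorphic_padded_wheel7 by blast
  show "\<forall>\<Delta>::nat. \<Delta> \<ge> 4 \<longrightarrow>
           ur_chromatic_index (double_wheel \<Delta>) = (if \<Delta> = 4 then 2 * \<Delta> + 4 else 2 * \<Delta>) \<and>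
           ss_chromatic_index (double_wheel \<Delta>) = (if \<Delta> = 4 \<or> \<Delta> = 7 then 2 * \<Delta> + 4 else 2 * \<Delta> + 3)"
    using ur_chromatic_index_double_wheel ss_chromatic_index_double_wheel by blast
qed

end
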